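(* Suppose that $(X,d,\mu)$ is a $(D,r_0)$-doubling metric measure space and satisfies a local non-homogeneous $(\Phi,\Psi,C,r_0)$-Poincaré inequality. Then the space $(X,d,\mu)$ is locally $(\overline C,\delta,\epsilon)$-connected and moreover admits a $(1,q)$-Poincaré inequality, for some $q\in[1,\infty)$ and some $\overline C\in[1,\infty)$, $\delta,\epsilon\in(0,1)$. All the variables are quantitative in the parameters.
   Context: Standing assumptions: metric measure spaces $(X,d,\mu)$ are complete and separable, $\mu$ is a Radon measure, and $0<\mu(B(x,r))<\infty$ for all open balls $B(x,r)$. Write $f_B=\frac{1}{\mu(B)}\int_B f\,d\mu$. $(D,r_0)$-doubling: $\mu(B(x,2r))\le D\,\mu(B(x,r))$ for all $x\in X$ and $r\in(0,r_0)$. Upper gradient: for Lipschitz $f:X\to\mathbb{R}$, a non-negative Borel function $g$ is an upper gradient of $f$ if $|f(\gamma(0))-f(\gamma(L))|\le\int_\gamma g\,ds$ for every rectifiable curve $\gamma:[0,L]\to X$. Non-homogeneous Poincaré inequality: let $\Phi,\Psi:[0,\infty)\to[0,\infty)$ be increasing functions with $\lim_{t\to0}\Phi(t)=\Phi(0)=0$ and $\lim_{t\to0}\Psi(t)=\Psi(0)=0$. The space satisfies a (local) non-homogeneous $(\Phi,\Psi,C,r_0)$-Poincaré inequality if for every $2$-Lipschitz function $f:X\to\mathbb{R}$, every upper gradient $g:X\to\mathbb{R}$ of $f$ and every ball $B(x,r)\subset X$ with $r<r_0$, $$\frac1{\mu(B(x,r))}\int_{B(x,r)}|f-f_{B(x,r)}|\,d\mu\le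 r\,\Psi\left(\frac1{\mu(B(x,Cr))}\int_{B(x,Cr)}\Phi\circ g\,d\mu\right).$$ Connectivity: a curve fragment is a Lipschitz map $\gamma:K\to X$ with $K\subset\mathbb{R}$ compact; it connects $x$ and $y$ if $\gamma(\min K)=x$ and $\gamma(\max K)=y$. Writing $[\min K,\max K]\setminus K=\bigcup_i(a_i,b_i)$ with disjoint maximal open intervals, set $\mathrm{gap}(\gamma)=\sum_i d(\gamma(a_i),\gamma(b_i))$; set $\mathrm{len}(\gamma)=\sup\sum_i d(\gamma(t_{i+1}),\gamma(t_i))$, the supremum being over finite sequences $t_1\le\dots\le t_n$ in $K$. For $C'\ge1$, $\delta>0$ and $0<\epsilon<1$, a pair $(x,y)$ with $r=d(x,y)>0$ is $(C',\delta,\epsilon)$-connected if for every Borel set $E$ with $\mu(E\cap B(x,C'r))<\epsilon\,\mu(B(x,C'r))$ there is a curve fragment $\gamma:K\to X$ connecting $x$ and $y$ with $\mathrm{len}(\gamma)\le C'd(x,y)$, $\mathrm{gap}(\gamma)<\delta d(x,y)$ and $\gamma^{-1}(E)\subset\{\min K,\max K\}$. The space is locally $(C',\delta,\epsilon)$-connected if for some $r_1>0$ every pair with $0<d(x,y)\le r_1$ is $(C',\delta,\epsilon)$-connected. $(1,q)$-Poincaré inequality: with $\mathrm{lip} f(x)=\liminf_{r\to0}\sup_{y\in B(x,r)}|f(x)-f(y)|/r$, the space admits a $(1,q)$-Poincaré inequality if there are constants $C',C_{PI}>0$ such that for every $r>0$, every $x\in X$ and every Lipschitz function $f:X\to\mathbb{R}$,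 $$\frac{1}{\mu(B(x,r))}\int_{B(x,r)}|f-f_{B(x,r)}|\,d\mu\le C_{PI}\,r\left(\frac{1}{\mu(B(x,C'r))}\int_{B(x,C'r)}(\mathrm{lip} f)^q\,d\mu\right)^{1/q}.$$
   Formalization: For finite r0 the (1,q)-Poincaré inequality is stated only for balls of radius r<R, with R>0 depending on the parameters (for all r>0 it fails: X={0,10}, counting measure, r0=1); for r0=∞ it holds for all r. Spaces are subsets of one ambient metric space (l-infinity contains all). *)

theory Defs
  imports "HOL-Analysis.Analysis"
begin

(* A metric measure space is a subset X of an ambient type 'a :: metric_space, with the induced
   metric dist, and a measure on the Borel sets of X.  X = UNIV gives a metric space type.
   A carrier set (rather than a type) is needed because the constants of the theorem are chosen
   before the space: they depend only on the parameters of the hypotheses.  For the instance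
   'a = (nat \<Rightarrow>\<^sub>C real), i.e. l-infinity, the spaces X range over all separable metric spaces up
   to isometry (Kuratowski embedding), so the constants are then uniform over all spaces.
   The open ball of X is X \<inter> ball x r with x \<in> X. *)

text \<open>Radon: finite on compact sets and inner regular with respect to compact sets.\<close>

definition radon_measure_on :: "'a::metric_space set \<Rightarrow> 'a measure \<Rightarrow> bool" where
  "radon_measure_on X \<mu> \<longleftrightarrow>
     sets \<mu> = sets (restrict_space borel X) \<and>
     (\<forall>K. compact K \<and> K \<subseteq> X \<longrightarrow> emeasure \<mu> K < \<infinity>) \<and>
     (\<forall>A\<in>sets \<mu>. emeasure \<mu> A = (SUP K\<in>{K. compact K \<and> K \<subseteq> A}. emeasure \<mu> K))"

definition metric_measure_space :: "'a::metric_space set \<Rightarrow> 'a measure \<Rightarrow> bool" where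
  "metric_measure_space X \<mu> \<longleftrightarrow>
     complete X \<and> separable_space (top_of_set X) \<and> radon_measure_on X \<mu> \<and>
     (\<forall>x\<in>X. \<forall>r>0. 0 < emeasure \<mu> (X \<inter> ball x r) \<and> emeasure \<mu> (X \<inter> ball x r) < \<infinity>)"

definition avg :: "'a measure \<Rightarrow> 'a set \<Rightarrow> ('a \<Rightarrow> real) \<Rightarrow> real" where
  "avg \<mu> B f = (LINT y:B|\<mu>. f y) / measure \<mu> B"

definition mean_oscillation :: "'a measure \<Rightarrow> 'a set \<Rightarrow> ('a \<Rightarrow> real) \<Rightarrow> real" where
  "mean_oscillation \<mu> B f = avg \<mu> B (\<lambda>y. \<bar>f y - avg \<mu> B f\<bar>)"

definition doubling :: "real \<Rightarrow> ereal \<Rightarrow> 'a::metric_space set \<Rightarrow> 'a measure \<Rightarrow> bool" where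
  "doubling D r0 X \<mu> \<longleftrightarrow>
     (\<forall>x\<in>X. \<forall>r>0. ereal r < r0 \<longrightarrow>
        measure \<mu> (X \<inter> ball x (2 * r)) \<le> D * measure \<mu> (X \<inter> ball x r))"

text \<open>The same length functional serves curves (\<open>K = {0..L}\<close>) and curve fragments
  (\<open>K\<close> compact).\<close>

definition curve_len :: "real set \<Rightarrow> (real \<Rightarrow> 'a::metric_space) \<Rightarrow> ennreal" where
  "curve_len K \<gamma> =
     (SUP ts\<in>{ts. sorted ts \<and> set ts \<subseteq> K}.
        \<Sum>i<length ts - 1. ennreal (dist (\<gamma> (ts ! Suc i)) (\<gamma> (ts ! i))))"

definition rectifiable_curve :: "'a::metric_space set \<Rightarrow> real \<Rightarrow> (real \<Rightarrow> 'a) \<Rightarrow> bool" where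
  "rectifiable_curve X L \<gamma> \<longleftrightarrow>
     0 \<le> L \<and> continuous_on {0..L} \<gamma> \<and> \<gamma> ` {0..L} \<subseteq> X \<and> curve_len {0..L} \<gamma> < \<infinity>"

text \<open>Arc-length reparametrization: \<open>arc_param L \<gamma> s = \<gamma> t\<close> for any \<open>t\<close> such that \<open>\<gamma>\<close> restricted to
  \<open>{0..t}\<close> has length \<open>s\<close>.  The value does not depend on the choice of \<open>t\<close> since \<open>\<gamma>\<close> is constant
  between two such parameters.\<close>

definition arc_param :: "real \<Rightarrow> (real \<Rightarrow> 'a::metric_space) \<Rightarrow> real \<Rightarrow> 'a" where
  "arc_param L \<gamma> s = \<gamma> (inv_into {0..L} (\<lambda>t. enn2real (curve_len {0..t} \<gamma>)) s)"

definition curve_integral ::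
    "real \<Rightarrow> (real \<Rightarrow> 'a::metric_space) \<Rightarrow> ('a \<Rightarrow> real) \<Rightarrow> ennreal" where
  "curve_integral L \<gamma> g =
     (\<integral>\<^sup>+ s\<in>{0..enn2real (curve_len {0..L} \<gamma>)}. ennreal (g (arc_param L \<gamma> s)) \<partial>lborel)"

definition upper_gradient ::
    "'a::metric_space set \<Rightarrow> ('a \<Rightarrow> real) \<Rightarrow> ('a \<Rightarrow> real) \<Rightarrow> bool" where
  "upper_gradient X f g \<longleftrightarrow>
     g \<in> borel_measurable (restrict_space borel X) \<and> (\<forall>x\<in>X. 0 \<le> g x) \<and>
     (\<forall>L \<gamma>. rectifiable_curve X L \<gamma> \<longrightarrow>
        ennreal \<bar>f (\<gamma> 0) - f (\<gamma> L)\<bar> \<le> curve_integral L \<gamma> g)"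

text \<open>Increasing functions \<open>[0,\<infinity>) \<rightarrow> [0,\<infinity>)\<close> that vanish at 0 and are continuous there;
  only their values on \<open>{0..}\<close> are used.\<close>

definition increasing_modulus :: "(real \<Rightarrow> real) \<Rightarrow> bool" where
  "increasing_modulus \<Phi> \<longleftrightarrow>
     mono_on {0..} \<Phi> \<and> (\<forall>t\<ge>0. 0 \<le> \<Phi> t) \<and> \<Phi> 0 = 0 \<and> (\<Phi> \<longlongrightarrow> 0) (at_right 0)"

text \<open>If \<open>\<Phi> \<circ> g\<close> is not integrable over \<open>B(x,Cr)\<close>, the right-hand side of the inequality is read
  as \<open>\<infinity>\<close> and nothing is required.\<close>

definition nonhomogeneous_Poincare ::
    "(real \<Rightarrow> real) \<Rightarrow> (real \<Rightarrow> real) \<Rightarrow> real \<Rightarrow> ereal \<Rightarrow> 'a::metric_space set \<Rightarrow> 'a measure \<Rightarrow> bool"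
  where
  "nonhomogeneous_Poincare \<Phi> \<Psi> C r0 X \<mu> \<longleftrightarrow>
     (\<forall>f g. 2-lipschitz_on X f \<and> upper_gradient X f g \<longrightarrow>
        (\<forall>x\<in>X. \<forall>r>0. ereal r < r0 \<longrightarrow>
           set_integrable \<mu> (X \<inter> ball x (C * r)) (\<Phi> \<circ> g) \<longrightarrow>
           mean_oscillation \<mu> (X \<inter> ball x r) f
             \<le> r * \<Psi> (avg \<mu> (X \<inter> ball x (C * r)) (\<Phi> \<circ> g))))"

definition curve_fragment ::
    "'a::metric_space set \<Rightarrow> real set \<Rightarrow> (real \<Rightarrow> 'a) \<Rightarrow> bool" where
  "curve_fragment X K \<gamma> \<longleftrightarrow>
     compact K \<and> K \<noteq> {} \<and> \<gamma> ` K \<subseteq> X \<and> (\<exists>L. L-lipschitz_on K \<gamma>)"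

text \<open>For a nonempty compact \<open>K\<close>, \<open>Inf K\<close> and \<open>Sup K\<close> are its minimum and maximum.\<close>

definition connects :: "real set \<Rightarrow> (real \<Rightarrow> 'a) \<Rightarrow> 'a \<Rightarrow> 'a \<Rightarrow> bool" where
  "connects K \<gamma> x y \<longleftrightarrow> \<gamma> (Inf K) = x \<and> \<gamma> (Sup K) = y"

text \<open>The maximal open intervals \<open>(a,b)\<close> of \<open>[min K, max K] - K\<close> are its connected components.\<close>

definition gap :: "real set \<Rightarrow> (real \<Rightarrow> 'a::metric_space) \<Rightarrow> ennreal" where
  "gap K \<gamma> =
     (\<Sum>\<^sub>\<infinity>I\<in>components ({Inf K..Sup K} - K). ennreal (dist (\<gamma> (Inf I)) (\<gamma> (Sup I))))"

definition connected_pair ::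
    "real \<Rightarrow> real \<Rightarrow> real \<Rightarrow> 'a::metric_space set \<Rightarrow> 'a measure \<Rightarrow> 'a \<Rightarrow> 'a \<Rightarrow> bool" where
  "connected_pair C \<delta> \<epsilon> X \<mu> x y \<longleftrightarrow>
     (\<forall>E\<in>sets \<mu>.
        measure \<mu> (E \<inter> ball x (C * dist x y)) < \<epsilon> * measure \<mu> (X \<inter> ball x (C * dist x y)) \<longrightarrow>
        (\<exists>K \<gamma>. curve_fragment X K \<gamma> \<and> connects K \<gamma> x y \<and>
           curve_len K \<gamma> \<le> ennreal (C * dist x y) \<and>
           gap K \<gamma> < ennreal (\<delta> * dist x y) \<and>
           {t\<in>K. \<gamma> t \<in> E} \<subseteq> {Inf K, Sup K}))"

text \<open>Local connectivity, with the scale \<open>r1\<close> explicit.\<close>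

definition locally_connected_at_scale ::
    "real \<Rightarrow> real \<Rightarrow> real \<Rightarrow> real \<Rightarrow> 'a::metric_space set \<Rightarrow> 'a measure \<Rightarrow> bool" where
  "locally_connected_at_scale r1 C \<delta> \<epsilon> X \<mu> \<longleftrightarrow>
     (\<forall>x\<in>X. \<forall>y\<in>X. 0 < dist x y \<and> dist x y \<le> r1 \<longrightarrow> connected_pair C \<delta> \<epsilon> X \<mu> x y)"

text \<open>The liminf is formed in \<open>ennreal\<close>; it is finite when \<open>f\<close> is Lipschitz, the only case in which
  the real-valued version is used.\<close>

definition lower_lip :: "'a::metric_space set \<Rightarrow> ('a \<Rightarrow> real) \<Rightarrow> 'a \<Rightarrow> real" where
  "lower_lip X f x =
     enn2real (Liminf (at_right 0)
       (\<lambda>r. SUP y\<in>X \<inter> ball x r. ennreal (\<bar>f x - f y\<bar> / r)))"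

text \<open>The \<open>(1,q)\<close>-Poincare inequality on balls of radius less than \<open>R\<close>.  For \<open>R = \<infinity>\<close> this is the
  inequality on all balls.\<close>

definition Poincare_1q ::
    "real \<Rightarrow> real \<Rightarrow> real \<Rightarrow> ereal \<Rightarrow> 'a::metric_space set \<Rightarrow> 'a measure \<Rightarrow> bool" where
  "Poincare_1q q C' C_PI R X \<mu> \<longleftrightarrow>
     (\<forall>f. (\<exists>L. L-lipschitz_on X f) \<longrightarrow>
        (\<forall>x\<in>X. \<forall>r>0. ereal r < R \<longrightarrow>
           mean_oscillation \<mu> (X \<inter> ball x r) f
             \<le> C_PI * r *
                (avg \<mu> (X \<inter> ball x (C' * r)) (\<lambda>y. lower_lip X f y powr q)) powr (1 / q)))"

end

theory Submission
  imports Defs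
begin

text \<open>Connectivity. Fix \<open>x\<close>, \<open>y\<close> at distance \<open>d\<close> and a small exceptional set, enlarged to a relatively
open set \<open>U\<close>. Give a 1-Lipschitz curve fragment on a compact \<open>K \<subseteq> [0,T]\<close> that avoids \<open>U\<close> the cost
\<open>(1 + \<tau>) T - |K|\<close>, that is, \<open>\<tau>\<close> times its total duration plus the measure of its gaps, and let
\<open>F z\<close> be the infimum of the costs of fragments from \<open>x\<close> to \<open>z\<close> (\<open>fragment_dist\<close>). A jump of
length \<open>l\<close> costs \<open>(1 + \<tau>) l\<close>, so \<open>F\<close> is 2-Lipschitz when \<open>\<tau> \<le> 1\<close>; appending to a fragment the part outside \<open>U\<close> of a
rectifiable curve shows that \<open>\<tau> + 1\<^sub>U\<close> is an upper gradient of \<open>F\<close>. The assumed Poincare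
inequality on \<open>B(x,2d)\<close> therefore bounds the mean oscillation of \<open>F\<close> by
\<open>2 d \<Psi> (\<Phi> \<tau> + \<Phi> 2 density(U))\<close>, which is as small a multiple of \<open>d\<close> as desired. Since \<open>F\<close> is Lipschitz
and the balls \<open>B(x, \<kappa> d)\<close>, \<open>B(y, \<kappa> d)\<close> fill a definite part of \<open>B(x,2d)\<close>, the value \<open>F y\<close> is smaller
than \<open>\<delta> d\<close>. A fragment of cost less than \<open>\<delta> d\<close> has gaps of total size less than \<open>\<delta> d\<close> and
length at most \<open>\<delta> d / \<tau>\<close>. This works for every \<open>\<delta>\<close> (\<open>joined_by_fragment_constants\<close>).\<close>

text \<open>Poincare inequality. Let \<open>f\<close> be Lipschitz, \<open>u = (lip f)\<^sup>q\<close>, and \<open>\<delta> = 1/4\<close>. The key is a pointwise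
Morrey estimate: if all averages of \<open>u\<close> over balls \<open>B(x,\<rho>)\<close>, \<open>\<rho> \<le> c d(x,y)\<close>, are at most \<open>\<nu>\<^sup>q\<close>,
then \<open>|f x - f y| \<le> C \<nu> d(x,y)\<close>. Suppose it holds with \<open>C \<nu> + A\<close> in place of \<open>C \<nu>\<close>; for \<open>A\<close> the
Lipschitz constant of \<open>f\<close> this is trivial. Join \<open>x\<close> to \<open>y\<close> by a fragment that avoids the points where
\<open>lip f \<ge> 2 \<nu>\<close> or where some average of \<open>u\<close> exceeds \<open>(2 \<nu>)\<^sup>q\<close>; by the Chebyshev and the weak type inequality these form
a set of density \<open>O(2\<^sup>-\<^sup>q)\<close>, so a fragment exists once \<open>q\<close> is large. Off the gaps \<open>f\<close> grows
at speed at most \<open>2 \<nu>\<close>, and across a gap the assumed estimate applies with \<open>2 \<nu>\<close>, because the left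
end of the gap is a point where the averages are controlled. As the gaps have total size below \<open>d/4\<close>, the
error \<open>A\<close> drops to \<open>A/4\<close> (\<open>Morrey_error_improves\<close>). Iterating, \<open>A\<close> can be taken to be \<open>0\<close>.

The estimate needs control of averages at one of the two points only. By the weak type inequality each
ball contains a point \<open>z\<close> where they are controlled, and comparing every other point of the
ball with \<open>z\<close> bounds the oscillation of \<open>f\<close>, which gives the \<open>(1,q)\<close>-Poincare inequality.\<close>

section \<open>Arc length parametrization\<close>

text \<open>A recursive form of the sums in \<^const>\<open>curve_len\<close>, suited to induction on the list of parameters.\<close>
fun list_variation :: "(real \<Rightarrow> 'a::metric_space) \<Rightarrow> real list \<Rightarrow> real" where
  "list_variation \<gamma> (s # t # ts) = dist (\<gamma> t) (\<gamma> s) + list_variation \<gamma> (t # ts)"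
| "list_variation \<gamma> _ = 0"

lemma list_variation_nonneg: "0 \<le> list_variation \<gamma> ts"
  by (induction \<gamma> ts rule: list_variation.induct) auto

lemma sum_dist_eq_list_variation:
  "(\<Sum>i<length ts - 1. dist (\<gamma> (ts ! Suc i)) (\<gamma> (ts ! i))) = list_variation \<gamma> ts"
  by (induction \<gamma> ts rule: list_variation.induct) (auto simp: sum.lessThan_Suc_shift simp del: sum.lessThan_Suc)

lemma curve_len_eq_SUP_list_variation:
  "curve_len K \<gamma> = (SUP ts\<in>{ts. sorted ts \<and> set ts \<subseteq> K}. ennreal (list_variation \<gamma> ts))"
  unfolding curve_len_def by (simp add: sum_ennreal flip: sum_dist_eq_list_variation)

lemma list_variation_append:
  "list_variation \<gamma> xs + list_variation \<gamma> ys \<le> list_variation \<gamma> (xs @ ys)"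
proof (induction \<gamma> xs rule: list_variation.induct)
  case ("2_2" \<gamma> v) then show ?case by (cases ys) auto
qed auto

text \<open>Truncating all parameters at \<open>s\<close> from above and from below is a way of inserting \<open>s\<close> into
the subdivision: only the pair that straddles \<open>s\<close> is affected, and there the triangle inequality applies.\<close>
lemma list_variation_split:
  "list_variation \<gamma> ts
    \<le> list_variation \<gamma> (map (\<lambda>u. min u s) ts) + list_variation \<gamma> (map (\<lambda>u. max u s) ts)"
proof (induction \<gamma> ts rule: list_variation.induct)
  case (1 \<gamma> u v ts)
  have "dist (\<gamma> v) (\<gamma> u)
     \<le> dist (\<gamma> (min v s)) (\<gamma> (min u s)) + dist (\<gamma> (max v s)) (\<gamma> (max u s))"
    using dist_triangle[of "\<gamma> v" "\<gamma> u" "\<gamma> s"]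
    by (auto simp: min_def max_def dist_commute algebra_simps)
  with 1 show ?case by simp
qed auto

lemma curve_len_le_of_lipschitz:
  assumes "1-lipschitz_on K \<gamma>" "K \<subseteq> {a..b}" "a \<le> b"
  shows "curve_len K \<gamma> \<le> ennreal (b - a)"
proof -
  have "list_variation \<gamma> ts \<le> b - (case ts of [] \<Rightarrow> a | t # _ \<Rightarrow> t)"
    if "sorted ts" "set ts \<subseteq> K" for ts
    using that
  proof (induction ts rule: induct_list012)
    case (2 x) then show ?case using assms by auto
  next
    case (3 x y zs)
    then have "dist (\<gamma> y) (\<gamma> x) \<le> dist y x"
      using lipschitz_onD[OF assms(1), of y x] by auto
    then show ?case using 3 by (auto simp: dist_real_def)
  qed (use assms in auto)
  moreover have "b - (case ts of [] \<Rightarrow> a | t # _ \<Rightarrow> t) \<le> b - a" if "set ts \<subseteq> K" for ts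
    using that assms by (cases ts) auto
  ultimately have "list_variation \<gamma> ts \<le> b - a" if "sorted ts" "set ts \<subseteq> K" for ts
    using that by (meson order_trans)
  then show ?thesis
    unfolding curve_len_eq_SUP_list_variation
    by (intro SUP_least ennreal_leI) simp
qed

text \<open>The length function of a continuous rectifiable curve takes every value between \<open>0\<close> and the total length.
This is what makes \<^const>\<open>arc_param\<close>, defined by means of \<^const>\<open>inv_into\<close>, meaningful.\<close>
context
  fixes \<gamma> :: "real \<Rightarrow> 'a::metric_space" and L :: real
  assumes L: "0 \<le> L" and cont: "continuous_on {0..L} \<gamma>" and fin: "curve_len {0..L} \<gamma> < \<infinity>"
begin

private definition len :: "real \<Rightarrow> real \<Rightarrow> real" where
  "len a b = enn2real (curve_len {a..b} \<gamma>)"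

private lemma curve_len_finite:
  assumes "0 \<le> a" "b \<le> L" shows "curve_len {a..b} \<gamma> < \<infinity>"
proof -
  have "curve_len {a..b} \<gamma> \<le> curve_len {0..L} \<gamma>"
    unfolding curve_len_def by (rule SUP_subset_mono) (use assms in auto)
  with fin show ?thesis by (rule order.strict_trans1[rotated])
qed

private lemma list_variation_le_len:
  assumes "0 \<le> a" "b \<le> L" "sorted ts" "set ts \<subseteq> {a..b}"
  shows "list_variation \<gamma> ts \<le> len a b"
proof -
  have "ennreal (list_variation \<gamma> ts) \<le> curve_len {a..b} \<gamma>"
    unfolding curve_len_eq_SUP_list_variation by (rule SUP_upper) (use assms in auto)
  then show ?thesis
    unfolding len_def using curve_len_finite[OF assms(1,2)]
    by (metis enn2real_ennreal enn2real_mono list_variation_nonneg infinity_ennreal_def)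
qed

private lemma len_le:
  assumes "\<And>ts. sorted ts \<Longrightarrow> set ts \<subseteq> {a..b} \<Longrightarrow> list_variation \<gamma> ts \<le> M"
  shows "len a b \<le> M"
proof -
  have "0 \<le> M" using assms[of "[]"] by simp
  moreover have "curve_len {a..b} \<gamma> \<le> ennreal M"
    unfolding curve_len_eq_SUP_list_variation
    by (intro SUP_least ennreal_leI) (use assms in auto)
  ultimately show ?thesis unfolding len_def by (simp add: enn2real_leI)
qed

private lemma len_superadditive:
  assumes "0 \<le> a" "a \<le> s" "s \<le> b" "b \<le> L"
  shows "len a s + len s b \<le> len a b"
proof -
  have "len a s \<le> len a b - len s b"
  proof (rule len_le)
    fix xs assume xs: "sorted xs" "set xs \<subseteq> {a..s}"
    have "len s b \<le> len a b - list_variation \<gamma> xs"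
    proof (rule len_le)
      fix ys assume ys: "sorted ys" "set ys \<subseteq> {s..b}"
      have "sorted (xs @ ys)" using xs ys by (fastforce simp: sorted_append)
      then have "list_variation \<gamma> (xs @ ys) \<le> len a b"
        using xs ys assms by (intro list_variation_le_len) auto
      then show "list_variation \<gamma> ys \<le> len a b - list_variation \<gamma> xs"
        using list_variation_append[of \<gamma> xs ys] by linarith
    qed
    then show "list_variation \<gamma> xs \<le> len a b - len s b" by simp
  qed
  then show ?thesis by simp
qed

private lemma len_subadditive:
  assumes "0 \<le> a" "a \<le> s" "s \<le> b" "b \<le> L"
  shows "len a b \<le> len a s + len s b"
proof (rule len_le)
  fix ts assume ts: "sorted ts" "set ts \<subseteq> {a..b}"
  have "list_variation \<gamma> (map (\<lambda>u. min u s) ts) \<le> len a s"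
    using ts assms by (intro list_variation_le_len sorted_map_mono) (auto simp: mono_on_def)
  moreover have "list_variation \<gamma> (map (\<lambda>u. max u s) ts) \<le> len s b"
    using ts assms by (intro list_variation_le_len sorted_map_mono) (auto simp: mono_on_def)
  ultimately show "list_variation \<gamma> ts \<le> len a s + len s b"
    using list_variation_split[of \<gamma> ts s] by linarith
qed

private lemma dist_le_len:
  assumes "0 \<le> s" "s \<le> t" "t \<le> L"
  shows "dist (\<gamma> s) (\<gamma> t) \<le> len 0 t - len 0 s"
proof -
  have "list_variation \<gamma> [s, t] \<le> len s t"
    using assms by (intro list_variation_le_len) auto
  then show ?thesis using len_superadditive[of 0 s t] assms by (auto simp: dist_commute)
qed

private lemma list_variation_continuous:
  fixes h :: "real \<Rightarrow> real \<Rightarrow> real"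
  assumes "\<And>u. u \<in> set ts \<Longrightarrow> continuous_on S (\<lambda>t. \<gamma> (h u t))"
  shows "continuous_on S (\<lambda>t. list_variation \<gamma> (map (\<lambda>u. h u t) ts))"
  using assms by (induction ts rule: induct_list012) (auto intro!: continuous_intros)

text \<open>At the supremum \<open>t\<close> of the parameters where the length is at most \<open>s\<close> there is no jump. Both halves use
that length is lower semicontinuous: a subdivision sum changes continuously when its
parameters are truncated at a varying point. Applied to \<open>[0,t]\<close> this excludes a jump at \<open>t\<close> from the left, and
applied to the remaining part \<open>[t,L]\<close>, with additivity, a jump from the right.\<close>
private lemma len_surj:
  assumes "0 \<le> s" "s \<le> len 0 L"
  shows "\<exists>t\<in>{0..L}. len 0 t = s"
proof -
  define T where "T = {t\<in>{0..L}. len 0 t \<le> s}"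
  define t where "t = Sup T"
  have len0: "len 0 0 = 0"
    using len_superadditive[of 0 0 0] list_variation_le_len[of 0 0 "[]"] L by auto
  have "0 \<in> T" using assms L by (auto simp: T_def len0)
  have bdd: "bdd_above T" by (auto simp: T_def bdd_above_def)
  have t: "t \<in> {0..L}"
  proof -
    have "0 \<le> t" unfolding t_def using \<open>0 \<in> T\<close> bdd by (rule cSup_upper)
    moreover have "t \<le> L"
      unfolding t_def using \<open>0 \<in> T\<close> by (intro cSup_least) (auto simp: T_def)
    ultimately show ?thesis by simp
  qed
  have mono: "len 0 a \<le> len 0 b" if "0 \<le> a" "a \<le> b" "b \<le> L" for a b
    using dist_le_len[OF that] zero_le_dist[of "\<gamma> a" "\<gamma> b"] by linarith
  have below: "u \<in> T" if "0 \<le> u" "u < t" for u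
  proof -
    have "T \<noteq> {}" using \<open>0 \<in> T\<close> by blast
    then obtain v where v: "v \<in> T" "u < v"
      using \<open>u < t\<close> less_cSup_iff[OF _ bdd, of u] unfolding t_def by blast
    then have "v \<le> L" "len 0 v \<le> s" by (simp_all add: T_def)
    then show ?thesis using mono[of u v] \<open>0 \<le> u\<close> v(2) by (simp add: T_def)
  qed
  have "len 0 t \<le> s"
  proof (rule len_le, rule ccontr)
    fix ts assume ts: "sorted ts" "set ts \<subseteq> {0..t}" and "\<not> list_variation \<gamma> ts \<le> s"
    define V where "V = (\<lambda>v. list_variation \<gamma> (map (\<lambda>u. min u v) ts))"
    have tsL: "0 \<le> u \<and> u \<le> L" if "u \<in> set ts" for u
      using subsetD[OF ts(2) that] t by auto
    have "continuous_on {0..L} V"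
      unfolding V_def
      by (intro list_variation_continuous continuous_on_compose2[OF cont] continuous_intros)
         (auto simp: le_max_iff_disj min_le_iff_disj dest: tsL)
    moreover have "map (\<lambda>u. min u t) ts = ts"
      using ts by (auto intro!: map_idI)
    then have "V t > s"
      using \<open>\<not> _\<close> by (simp add: V_def)
    ultimately have "eventually (\<lambda>v. V v > s) (at t within {0..L})"
      using t by (metis continuous_on_def order_tendstoD(1))
    then obtain d where d: "d > 0" "\<And>v. v \<in> {0..L} \<Longrightarrow> v \<noteq> t \<Longrightarrow> dist v t < d \<Longrightarrow> V v > s"
      unfolding eventually_at by blast
    have "t \<noteq> 0"
    proof
      assume "t = 0"
      then have "list_variation \<gamma> ts \<le> 0" using list_variation_le_len[of 0 0 ts] ts L len0 by auto
      with \<open>\<not> _\<close> assms show False by simp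
    qed
    define v where "v = max 0 (t - d / 2)"
    have v: "0 \<le> v" "v < t" "dist v t < d"
      using \<open>t \<noteq> 0\<close> t d(1) by (auto simp: v_def dist_real_def)
    have "V v \<le> len 0 v"
      unfolding V_def using ts v t
      by (intro list_variation_le_len sorted_map_mono) (auto simp: mono_on_def)
    moreover have "V v > s" using d(2)[of v] v t by auto
    ultimately show False using below[of v] v by (auto simp: T_def)
  qed
  moreover have "s \<le> len 0 t"
  proof (rule ccontr)
    assume "\<not> s \<le> len 0 t"
    then have "t < L" using t assms by (cases "t = L") auto
    have "len 0 L - s < len t L"
      using len_subadditive[of 0 t L] t \<open>\<not> s \<le> _\<close> by auto
    then obtain ts where ts: "sorted ts" "set ts \<subseteq> {t..L}" "len 0 L - s < list_variation \<gamma> ts"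
      using len_le[of t L "len 0 L - s"] by force
    define V where "V = (\<lambda>v. list_variation \<gamma> (map (\<lambda>u. max u v) ts))"
    have tsL: "0 \<le> u \<and> u \<le> L" if "u \<in> set ts" for u
      using subsetD[OF ts(2) that] t by auto
    have "continuous_on {0..L} V"
      unfolding V_def
      by (intro list_variation_continuous continuous_on_compose2[OF cont] continuous_intros)
         (auto simp: le_max_iff_disj min_le_iff_disj dest: tsL)
    moreover have "map (\<lambda>u. max u t) ts = ts"
      using ts by (auto intro!: map_idI)
    then have "V t > len 0 L - s"
      using ts by (simp add: V_def)
    ultimately have "eventually (\<lambda>v. V v > len 0 L - s) (at t within {0..L})"
      using t by (metis continuous_on_def order_tendstoD(1))
    then obtain d where d: "d > 0"
        "\<And>v. v \<in> {0..L} \<Longrightarrow> v \<noteq> t \<Longrightarrow> dist v t < d \<Longrightarrow> V v > len 0 L - s"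
      unfolding eventually_at by blast
    define v where "v = min L (t + d / 2)"
    have v: "v \<le> L" "t < v" "dist v t < d" "0 \<le> v"
      using \<open>t < L\<close> t d(1) by (auto simp: v_def dist_real_def)
    have "V v \<le> len v L"
      unfolding V_def using ts v t
      by (intro list_variation_le_len sorted_map_mono) (auto simp: mono_on_def)
    moreover have "V v > len 0 L - s" using d(2)[of v] v t by auto
    ultimately have "v \<in> T"
      using len_superadditive[of 0 v L] v by (auto simp: T_def)
    then have "v \<le> t" unfolding t_def using bdd by (rule cSup_upper)
    with v show False by simp
  qed
  ultimately show ?thesis using t by force
qed

lemma arc_param_props:
  defines "l \<equiv> enn2real (curve_len {0..L} \<gamma>)"
  shows "1-lipschitz_on {0..l} (arc_param L \<gamma>)"
    and "arc_param L \<gamma> ` {0..l} \<subseteq> \<gamma> ` {0..L}"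
    and "arc_param L \<gamma> 0 = \<gamma> 0"
    and "arc_param L \<gamma> l = \<gamma> L"
proof -
  define \<tau> where "\<tau> = inv_into {0..L} (\<lambda>t. enn2real (curve_len {0..t} \<gamma>))"
  have l: "l = len 0 L" by (simp add: l_def len_def)
  have arc: "arc_param L \<gamma> s = \<gamma> (\<tau> s)" for s by (simp add: arc_param_def \<tau>_def)
  have \<tau>: "\<tau> s \<in> {0..L}" "len 0 (\<tau> s) = s" if "s \<in> {0..l}" for s
  proof -
    have "s \<in> len 0 ` {0..L}" using len_surj[of s] that l by force
    then show "\<tau> s \<in> {0..L}" "len 0 (\<tau> s) = s"
      unfolding \<tau>_def len_def by (rule inv_into_into, rule f_inv_into_f)
  qed
  have dist: "dist (\<gamma> a) (\<gamma> b) \<le> \<bar>len 0 a - len 0 b\<bar>" if "a \<in> {0..L}" "b \<in> {0..L}" for a b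
  proof (cases "a \<le> b")
    case True
    then show ?thesis using dist_le_len[of a b] that by simp
  next
    case False
    then show ?thesis using dist_le_len[of b a] that by (simp add: dist_commute)
  qed
  show "1-lipschitz_on {0..l} (arc_param L \<gamma>)"
  proof (rule lipschitz_onI)
    fix a b assume "a \<in> {0..l}" "b \<in> {0..l}"
    then show "dist (arc_param L \<gamma> a) (arc_param L \<gamma> b) \<le> 1 * dist a b"
      using dist[OF \<tau>(1) \<tau>(1), of a b] by (simp only: arc dist_real_def \<tau>(2) mult_1)
  qed simp
  show "arc_param L \<gamma> ` {0..l} \<subseteq> \<gamma> ` {0..L}" using \<tau> by (auto simp: arc)
  have l0: "0 \<le> l" by (simp add: l_def)
  have len0: "len 0 0 = 0"
    using len_superadditive[of 0 0 0] list_variation_le_len[of 0 0 "[]"] L by auto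
  show "arc_param L \<gamma> 0 = \<gamma> 0"
    using dist[of "\<tau> 0" 0] \<tau>[of 0] l0 L by (auto simp: arc len0)
  show "arc_param L \<gamma> l = \<gamma> L"
    using dist[of "\<tau> l" L] \<tau>[of l] l0 L by (auto simp: arc l)
qed

end

section \<open>Curve fragments and their costs\<close>

text \<open>The ends of a component \<open>I\<close> of the complement of \<open>K\<close> lie in \<open>K\<close>, since otherwise \<open>I\<close> could be
enlarged by them. So the Lipschitz bound applies across \<open>I\<close>, and the gap is at most the
measure of \<open>I\<close>; the components are disjoint.\<close>
lemma gap_le_measure:
  assumes K: "compact K" "K \<subseteq> {0..T}" "0 \<in> K" "T \<in> K" and lip: "1-lipschitz_on K \<gamma>"
  shows "gap K \<gamma> \<le> ennreal (T - measure lebesgue K)"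
proof -
  define V where "V = {0..T} - K"
  have ends: "Inf K = 0" "Sup K = T"
    using K by (auto intro!: cInf_eq_minimum cSup_eq_maximum)
  have "V = {0<..<T} - K"
    using K by (auto simp: V_def less_le) 
  then have "open V" using compact_imp_closed[OF K(1)] by (auto intro: open_Diff)
  have comp: "open I" "connected I" "I \<noteq> {}" "I \<subseteq> V" if "I \<in> components V" for I
    using that \<open>open V\<close> in_components_connected in_components_nonempty in_components_subset
      open_components by blast+
  have bdd: "bdd_below I" "bdd_above I" if "I \<subseteq> V" for I
    using that by (auto simp: V_def intro!: bdd_belowI[of _ 0] bdd_aboveI[of _ T])
  have maximal: "p \<in> I" if "I \<in> components V" "p \<in> closure I" "p \<notin> K" for I p
  proof -
    have "closure I \<subseteq> {0..T}"
      using comp(4)[OF that(1)] by (intro closure_minimal) (auto simp: V_def)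
    then have "insert p I \<subseteq> V" using that comp(4)[OF that(1)] by (auto simp: V_def)
    moreover have "connected (insert p I)"
      by (rule connected_intermediate_closure[OF comp(2)[OF that(1)]])
         (use that(2) closure_subset in auto)
    ultimately have "insert p I \<subseteq> I"
      using components_maximal[OF that(1), of "insert p I"] comp(3)[OF that(1)] by blast
    then show ?thesis by simp
  qed
  have Inf_K: "Inf I \<in> K" if "I \<in> components V" for I
  proof (rule ccontr)
    note I = comp[OF that] bdd[OF comp(4)[OF that]]
    assume "Inf I \<notin> K"
    then have "Inf I \<in> I" using maximal[OF that] closure_contains_Inf I by blast
    then obtain e where "e > 0" "ball (Inf I) e \<subseteq> I" using \<open>open I\<close> openE by blast
    then have "Inf I - e / 2 \<in> I" by (auto simp: subset_eq dist_real_def)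
    then have "Inf I \<le> Inf I - e / 2" using I by (intro cInf_lower)
    with \<open>e > 0\<close> show False by simp
  qed
  have Sup_K: "Sup I \<in> K" if "I \<in> components V" for I
  proof (rule ccontr)
    note I = comp[OF that] bdd[OF comp(4)[OF that]]
    assume "Sup I \<notin> K"
    then have "Sup I \<in> I" using maximal[OF that] closure_contains_Sup I by blast
    then obtain e where "e > 0" "ball (Sup I) e \<subseteq> I" using \<open>open I\<close> openE by blast
    then have "Sup I + e / 2 \<in> I" by (auto simp: subset_eq dist_real_def)
    then have "Sup I + e / 2 \<le> Sup I" using I by (intro cSup_upper)
    with \<open>e > 0\<close> show False by simp
  qed
  have jump: "ennreal (dist (\<gamma> (Inf I)) (\<gamma> (Sup I))) \<le> emeasure lborel I" if "I \<in> components V" for I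
  proof -
    note I = comp[OF that] bdd[OF comp(4)[OF that]]
    have le: "Inf I \<le> Sup I" using I by (meson cInf_le_cSup)
    have "dist (\<gamma> (Inf I)) (\<gamma> (Sup I)) \<le> Sup I - Inf I"
      using lipschitz_onD[OF lip Inf_K[OF that] Sup_K[OF that]] le by (simp add: dist_real_def)
    then have "ennreal (dist (\<gamma> (Inf I)) (\<gamma> (Sup I))) \<le> emeasure lborel {Inf I<..<Sup I}"
      using le by (simp add: ennreal_leI)
    also have "{Inf I<..<Sup I} \<subseteq> I"
    proof
      fix u assume "u \<in> {Inf I<..<Sup I}"
      then obtain a b where "a \<in> I" "a < u" "b \<in> I" "u < b"
        using I by (auto simp: cInf_less_iff less_cSup_iff)
      then show "u \<in> I" using connected_contains_Icc[OF I(2), of a b] by auto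
    qed
    then have "emeasure lborel {Inf I<..<Sup I} \<le> emeasure lborel I"
      using I by (intro emeasure_mono) auto
    finally show ?thesis .
  qed
  have "gap K \<gamma> \<le> emeasure lborel V"
    unfolding gap_def ends V_def[symmetric]
  proof (subst nonneg_infsum_complete, goal_cases)
    case 2 show ?case
    proof (rule SUP_least, clarify)
      fix F assume F: "finite F" "F \<subseteq> components V"
      then have FV: "\<forall>I\<in>F. open I \<and> I \<subseteq> V" using comp by blast
      have "(\<Sum>I\<in>F. ennreal (dist (\<gamma> (Inf I)) (\<gamma> (Sup I)))) \<le> (\<Sum>I\<in>F. emeasure lborel I)"
        using F jump by (intro sum_mono) auto
      also have "\<dots> = emeasure lborel (\<Union>I\<in>F. I)"
      proof (rule sum_emeasure)
        show "disjoint_family_on (\<lambda>I. I) F"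
          using F components_nonoverlap[of _ V] unfolding disjoint_family_on_def by blast
      qed (use F(1) FV in auto)
      also have "\<dots> \<le> emeasure lborel V"
        using FV \<open>open V\<close> by (intro emeasure_mono) auto
      finally show "(\<Sum>I\<in>F. ennreal (dist (\<gamma> (Inf I)) (\<gamma> (Sup I)))) \<le> emeasure lborel V" .
    qed
  qed auto
  also have "emeasure lborel V = emeasure lebesgue V"
    using \<open>open V\<close> by simp
  also have "\<dots> = ennreal (measure lebesgue V)"
    unfolding V_def using K
    by (intro emeasure_eq_measure2 fmeasurable.Diff) (auto simp: lmeasurable_compact)
  also have "measure lebesgue V = T - measure lebesgue K"
    unfolding V_def using K
    by (subst measurable_measure_Diff) (auto intro: lmeasurable_compact fmeasurableD)
  finally show ?thesis .
qed

text \<open>A 1-Lipschitz fragment on \<open>K\<close> that avoids \<open>U\<close>, together with its two end points at the times \<open>0\<close> and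
\<open>T\<close>, which need not belong to \<open>K\<close> and so may lie in \<open>U\<close>. Since \<open>K\<close> may be empty, any two points are
connected by such a fragment.\<close>
definition unit_fragment ::
  "'a::metric_space set \<Rightarrow> 'a set \<Rightarrow> 'a \<Rightarrow> 'a \<Rightarrow> real \<Rightarrow> real set \<Rightarrow> (real \<Rightarrow> 'a) \<Rightarrow> bool" where
  "unit_fragment X U x z T K \<gamma> \<longleftrightarrow>
     0 \<le> T \<and> compact K \<and> K \<subseteq> {0..T} \<and> 1-lipschitz_on (insert 0 (insert T K)) \<gamma> \<and>
     \<gamma> ` insert 0 (insert T K) \<subseteq> X \<and> \<gamma> 0 = x \<and> \<gamma> T = z \<and> \<gamma> ` K \<inter> U = {}"

text \<open>The sum of \<open>\<tau> T\<close> and of the measure \<open>T - |K|\<close> of the gaps.\<close>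
definition fragment_cost :: "real \<Rightarrow> real \<Rightarrow> real set \<Rightarrow> real" where
  "fragment_cost \<tau> T K = (1 + \<tau>) * T - measure lebesgue K"

definition fragment_dist :: "'a::metric_space set \<Rightarrow> 'a set \<Rightarrow> real \<Rightarrow> 'a \<Rightarrow> 'a \<Rightarrow> real" where
  "fragment_dist X U \<tau> x z = Inf {fragment_cost \<tau> T K |T K. \<exists>\<gamma>. unit_fragment X U x z T K \<gamma>}"

lemma fragment_cost_ge:
  assumes "unit_fragment X U x z T K \<gamma>"
  shows "\<tau> * T \<le> fragment_cost \<tau> T K"
proof -
  have "measure lebesgue K \<le> measure lebesgue {0..T}"
    using assms by (intro measure_mono_fmeasurable) (auto simp: unit_fragment_def lmeasurable_compact fmeasurableD)
  then show ?thesis using assms by (auto simp: fragment_cost_def unit_fragment_def algebra_simps)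
qed

lemma unit_fragment_jump:
  assumes "x \<in> X" "z \<in> X"
  shows "unit_fragment X U x z (dist x z) {} (\<lambda>t. if t = 0 then x else z)"
  using assms by (auto simp: unit_fragment_def lipschitz_on_def dist_real_def dist_commute)

lemma unit_fragment_of_curve:
  assumes "0 \<le> T" "1-lipschitz_on {0..T} \<sigma>" "\<sigma> ` {0..T} \<subseteq> X"
    "compact K" "K \<subseteq> {0..T}" "\<sigma> ` K \<inter> U = {}"
  shows "unit_fragment X U (\<sigma> 0) (\<sigma> T) T K \<sigma>"
proof -
  have sub: "insert 0 (insert T K) \<subseteq> {0..T}" using assms by auto
  then have "\<sigma> ` insert 0 (insert T K) \<subseteq> X" using assms(3) by blast
  then show ?thesis
    unfolding unit_fragment_def using assms lipschitz_on_subset[OF assms(2) sub] by blast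
qed

text \<open>The junction time \<open>T\<close> is dropped from the domain unless it belongs to one of the two pieces. This is
harmless for the Lipschitz condition, which across the junction follows from the triangle inequality through \<open>y\<close>,
and it is needed when \<open>y\<close> lies in \<open>U\<close>.\<close>
lemma unit_fragment_append:
  assumes "unit_fragment X U x y T K \<gamma>" "unit_fragment X U y z l J \<sigma>"
  shows "unit_fragment X U x z (T + l) (K \<union> (+) T ` J) (\<lambda>t. if t \<le> T then \<gamma> t else \<sigma> (t - T))"
    (is "unit_fragment _ _ _ _ _ ?K ?\<gamma>")
proof -
  note a = assms[unfolded unit_fragment_def]
  have lip: "1-lipschitz_on (insert 0 (insert T K)) \<gamma>" "1-lipschitz_on (insert 0 (insert l J)) \<sigma>"
    using a by blast+
  have right: "?\<gamma> (T + s) = \<sigma> s" if "0 \<le> s" for s using that a by auto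
  have near: "dist (\<gamma> s) y \<le> T - s" if "s \<in> insert 0 (insert T K)" for s
  proof -
    have "s \<le> T" using that a by auto
    then show ?thesis
      using lipschitz_onD[OF lip(1) that, of T] a by (simp add: dist_real_def)
  qed
  have near': "dist y (\<sigma> s) \<le> s" if "s \<in> insert 0 (insert l J)" for s
  proof -
    have "0 \<le> s" using that a by auto
    then show ?thesis
      using lipschitz_onD[OF lip(2) _ that, of 0] a by (simp add: dist_real_def)
  qed
  have pts: "(t \<le> T \<and> t \<in> insert 0 (insert T K)) \<or> (t > T \<and> t - T \<in> insert 0 (insert l J))"
    if "t \<in> insert 0 (insert (T + l) ?K)" for t
    using that a by force
  have *: "dist (?\<gamma> s) (?\<gamma> t) \<le> t - s"
    if "s \<in> insert 0 (insert (T + l) ?K)" "t \<in> insert 0 (insert (T + l) ?K)" "s \<le> t" for s t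
    using pts[OF that(1)] pts[OF that(2)]
  proof (elim disjE conjE)
    assume "s \<le> T" "s \<in> insert 0 (insert T K)" "t \<le> T" "t \<in> insert 0 (insert T K)"
    then show ?thesis
      using lipschitz_onD[OF lip(1), of s t] that(3) by (simp add: dist_real_def)
  next
    assume "s \<le> T" "s \<in> insert 0 (insert T K)" "T < t" "t - T \<in> insert 0 (insert l J)"
    then show ?thesis
      using near[of s] near'[of "t - T"] dist_triangle[of "\<gamma> s" "\<sigma> (t - T)" y] by simp
  next
    assume "T < s" "s - T \<in> insert 0 (insert l J)" "T < t" "t - T \<in> insert 0 (insert l J)"
    then show ?thesis
      using lipschitz_onD[OF lip(2), of "s - T" "t - T"] that(3)
      by (simp add: dist_real_def)
  qed (use that in auto)
  have "1-lipschitz_on (insert 0 (insert (T + l) ?K)) ?\<gamma>"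
  proof (rule lipschitz_onI)
    fix s t assume st: "s \<in> insert 0 (insert (T + l) ?K)" "t \<in> insert 0 (insert (T + l) ?K)"
    show "dist (?\<gamma> s) (?\<gamma> t) \<le> 1 * dist s t"
      using *[OF st] *[OF st(2,1)] by (cases "s \<le> t") (simp_all only: dist_real_def dist_commute, auto)
  qed simp
  moreover have "?\<gamma> t \<in> X" if "t \<in> insert 0 (insert (T + l) ?K)" for t
    using pts[OF that] a by auto
  moreover have "?\<gamma> t \<notin> U" if "t \<in> ?K" for t
    using that a right by (auto simp: disjoint_iff subset_eq)
  moreover have "compact ?K" using a by (auto intro: compact_translation)
  moreover have "?\<gamma> (T + l) = z" "?\<gamma> 0 = x" using right[of l] a by auto
  moreover have "0 \<le> T + l" "?K \<subseteq> {0..T + l}" using a by force+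
  ultimately show ?thesis
    unfolding unit_fragment_def image_subset_iff disjoint_iff by blast
qed

lemma fragment_cost_append:
  assumes "unit_fragment X U x y T K \<gamma>" "unit_fragment X U y z l J \<sigma>"
  shows "fragment_cost \<tau> (T + l) (K \<union> (+) T ` J) = fragment_cost \<tau> T K + fragment_cost \<tau> l J"
proof -
  note a = assms[unfolded unit_fragment_def]
  have "compact ((+) T ` J)" using a by (auto intro: compact_translation)
  then have "measure lebesgue (K \<union> (+) T ` J)
     = measure lebesgue K + measure lebesgue ((+) T ` J) - measure lebesgue (K \<inter> (+) T ` J)"
    using a by (intro measure_Un3) (auto intro: lmeasurable_compact)
  moreover have "negligible (K \<inter> (+) T ` J)"
  proof (rule negligible_subset[of "{T}"])
    have "t \<le> T" if "t \<in> K" for t using a that by auto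
    moreover have "0 \<le> j" if "j \<in> J" for j using a that by auto
    ultimately show "K \<inter> (+) T ` J \<subseteq> {T}" by force
  qed simp
  then have "measure lebesgue (K \<inter> (+) T ` J) = 0" by (rule negligible_imp_measure0)
  ultimately show ?thesis
    using measure_translation[of T J] by (simp add: fragment_cost_def algebra_simps)
qed

context
  fixes X U :: "'a::metric_space set" and \<tau> :: real and x :: 'a
  assumes \<tau>: "0 \<le> \<tau>" and x: "x \<in> X"
begin

lemma fragment_dist_le:
  assumes "unit_fragment X U x z T K \<gamma>"
  shows "fragment_dist X U \<tau> x z \<le> fragment_cost \<tau> T K"
  unfolding fragment_dist_def
proof (rule cInf_lower)
  show "bdd_below {fragment_cost \<tau> T K |T K. \<exists>\<gamma>. unit_fragment X U x z T K \<gamma>}"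
  proof (rule bdd_belowI[of _ 0], clarify)
    fix T K \<gamma> assume f: "unit_fragment X U x z T K \<gamma>"
    then have "0 \<le> \<tau> * T" using \<tau> by (simp add: unit_fragment_def)
    then show "0 \<le> fragment_cost \<tau> T K" using fragment_cost_ge[OF f, of \<tau>] by linarith
  qed
qed (use assms in blast)

lemma fragment_dist_less:
  assumes "z \<in> X" "fragment_dist X U \<tau> x z < c"
  obtains T K \<gamma> where "unit_fragment X U x z T K \<gamma>" "fragment_cost \<tau> T K < c"
proof -
  have "{fragment_cost \<tau> T K |T K. \<exists>\<gamma>. unit_fragment X U x z T K \<gamma>} \<noteq> {}"
    using unit_fragment_jump[OF x assms(1)] by blast
  from cInf_lessD[OF this assms(2)[unfolded fragment_dist_def]] show ?thesis using that by blast
qed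

text \<open>This is the source of both properties of \<^const>\<open>fragment_dist\<close> below: applied to a jump it gives
the Lipschitz bound, applied to a rectifiable curve the upper gradient.\<close>
lemma fragment_dist_triangle:
  assumes "y \<in> X" "unit_fragment X U y z l J \<sigma>"
  shows "fragment_dist X U \<tau> x z \<le> fragment_dist X U \<tau> x y + fragment_cost \<tau> l J"
proof (rule field_le_epsilon)
  fix e :: real assume "e > 0"
  then obtain T K \<gamma> where f: "unit_fragment X U x y T K \<gamma>"
      "fragment_cost \<tau> T K < fragment_dist X U \<tau> x y + e"
    using fragment_dist_less[OF assms(1), of "fragment_dist X U \<tau> x y + e"] by auto
  show "fragment_dist X U \<tau> x z \<le> fragment_dist X U \<tau> x y + fragment_cost \<tau> l J + e"
    using fragment_dist_le[OF unit_fragment_append[OF f(1) assms(2)]]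
      fragment_cost_append[OF f(1) assms(2), of \<tau>] f(2) by linarith
qed

lemma fragment_dist_self: "fragment_dist X U \<tau> x x \<le> 0"
  using fragment_dist_le[OF unit_fragment_jump[OF x x]] by (simp add: fragment_cost_def)

lemma fragment_dist_lipschitz: "(1 + \<tau>)-lipschitz_on X (fragment_dist X U \<tau> x)"
proof (rule lipschitz_onI)
  have *: "fragment_dist X U \<tau> x z \<le> fragment_dist X U \<tau> x y + (1 + \<tau>) * dist y z"
    if "y \<in> X" "z \<in> X" for y z
    using fragment_dist_triangle[OF that(1) unit_fragment_jump[OF that]]
    by (simp add: fragment_cost_def)
  fix y z assume yz: "y \<in> X" "z \<in> X"
  show "dist (fragment_dist X U \<tau> x y) (fragment_dist X U \<tau> x z) \<le> (1 + \<tau>) * dist y z"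
    using *[OF yz] *[OF yz(2,1)] by (auto simp: dist_real_def dist_commute abs_le_iff)
qed (use \<tau> in auto)

text \<open>A rectifiable curve of length \<open>l\<close>, parametrized by arc length and restricted to the times \<open>J\<close> outside \<open>U\<close>,
is a fragment of cost \<open>\<tau> l + (l - |J|)\<close>, which is the integral of \<open>\<tau> + 1\<^sub>U\<close> along the curve.\<close>
lemma fragment_dist_upper_gradient:
  assumes U: "openin (top_of_set X) U"
  shows "upper_gradient X (fragment_dist X U \<tau> x) (\<lambda>z. \<tau> + indicator U z)"
  unfolding upper_gradient_def
proof (intro conjI allI impI ballI)
  obtain V where V: "open V" "U = X \<inter> V" using U by (auto simp: openin_open)
  show "(\<lambda>z. \<tau> + indicator U z) \<in> borel_measurable (restrict_space borel X)"
  proof -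
    have "U \<in> sets (restrict_space borel X)" using V by (auto simp: sets_restrict_space)
    then show ?thesis by measurable
  qed
  show "0 \<le> \<tau> + indicator U z" for z using \<tau> by (simp add: indicator_def)
  fix L :: real and \<gamma> assume rect: "rectifiable_curve X L \<gamma>"
  define l where "l = enn2real (curve_len {0..L} \<gamma>)"
  define \<sigma> where "\<sigma> = arc_param L \<gamma>"
  have l: "0 \<le> l" by (simp add: l_def)
  have \<sigma>: "1-lipschitz_on {0..l} \<sigma>" "\<sigma> ` {0..l} \<subseteq> X" "\<sigma> 0 = \<gamma> 0" "\<sigma> l = \<gamma> L"
    using arc_param_props[of L \<gamma>] rect unfolding l_def \<sigma>_def rectifiable_curve_def by blast+
  define J where "J = {s\<in>{0..l}. \<sigma> s \<notin> U}"
  have "J = {0..l} \<inter> \<sigma> -` (- V)" using \<sigma>(2) V by (auto simp: J_def image_subset_iff)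
  moreover have "closed ({0..l} \<inter> \<sigma> -` (- V))"
    using V by (intro continuous_closed_preimage lipschitz_on_continuous_on[OF \<sigma>(1)]) auto
  ultimately have J: "compact J" "J \<subseteq> {0..l}"
    by (metis bounded_Int bounded_closed_interval compact_eq_bounded_closed) (auto simp: J_def)
  have mJ: "measure lebesgue J \<le> l"
    using measure_mono_fmeasurable[of J "{0..l}" lebesgue] J l
    by (auto simp: lmeasurable_compact fmeasurableD)
  have forward: "unit_fragment X U (\<gamma> 0) (\<gamma> L) l J \<sigma>"
    using unit_fragment_of_curve[OF l \<sigma>(1,2) J, of U] \<sigma>(3,4) by (auto simp: J_def)
  \<comment> \<open>The reversed curve is needed because the triangle inequality bounds only one sign of the difference.\<close>
  define J' where "J' = (\<lambda>s. l - s) ` J"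
  have J': "compact J'" "measure lebesgue J' = measure lebesgue J"
    unfolding J'_def using J measure_lebesgue_affine[of "-1" l J]
    by (auto intro!: compact_continuous_image continuous_intros)
  have "1-lipschitz_on {0..l} (\<lambda>s. \<sigma> (l - s))"
  proof (rule lipschitz_onI)
    fix a b assume "a \<in> {0..l}" "b \<in> {0..l}"
    then show "dist (\<sigma> (l - a)) (\<sigma> (l - b)) \<le> 1 * dist a b"
      using lipschitz_onD[OF \<sigma>(1), of "l - a" "l - b"] by (simp add: dist_real_def abs_minus_commute)
  qed simp
  moreover have "(\<lambda>s. \<sigma> (l - s)) ` {0..l} \<subseteq> X" using \<sigma>(2) by (auto simp: image_subset_iff)
  moreover have "J' \<subseteq> {0..l}" using J(2) by (auto simp: J'_def)
  moreover have "(\<lambda>s. \<sigma> (l - s)) ` J' \<inter> U = {}" by (auto simp: J_def J'_def)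
  ultimately have backward: "unit_fragment X U (\<gamma> L) (\<gamma> 0) l J' (\<lambda>s. \<sigma> (l - s))"
    using unit_fragment_of_curve[OF l, of "\<lambda>s. \<sigma> (l - s)" X J' U] \<sigma>(3,4) J'(1) by simp
  have Jb [measurable]: "J \<in> sets borel" using J(1) by (rule borel_compact)
  have "curve_integral L \<gamma> (\<lambda>z. \<tau> + indicator U z)
     = (\<integral>\<^sup>+ s. ennreal (1 + \<tau>) * indicator ({0..l} - J) s + ennreal \<tau> * indicator J s \<partial>lborel)"
    unfolding curve_integral_def l_def[symmetric] \<sigma>_def[symmetric]
    by (intro nn_integral_cong) (auto simp: J_def indicator_def add.commute)
  also have "\<dots> = ennreal (1 + \<tau>) * emeasure lborel ({0..l} - J) + ennreal \<tau> * emeasure lborel J"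
    using Jb by (subst nn_integral_add) (simp_all add: nn_integral_cmult_indicator)
  also have "emeasure lborel ({0..l} - J) = emeasure lebesgue ({0..l} - J)"
    using J by (auto simp: borel_compact)
  also have "\<dots> = ennreal (measure lebesgue ({0..l} - J))"
    using J by (intro emeasure_eq_measure2 fmeasurable.Diff) (auto simp: lmeasurable_compact)
  also have "measure lebesgue ({0..l} - J) = l - measure lebesgue J"
    using J l by (subst measurable_measure_Diff) (auto intro: lmeasurable_compact)
  also have "emeasure lborel J = emeasure lebesgue J"
    using J by (auto simp: borel_compact)
  also have "\<dots> = ennreal (measure lebesgue J)"
    using J by (intro emeasure_eq_measure2) (auto intro!: lmeasurable_compact)
  also have "ennreal (1 + \<tau>) * ennreal (l - measure lebesgue J) + ennreal \<tau> * ennreal (measure lebesgue J)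
     = ennreal ((1 + \<tau>) * (l - measure lebesgue J) + \<tau> * measure lebesgue J)"
    using \<tau> mJ by (simp add: ennreal_mult ennreal_plus)
  also have "(1 + \<tau>) * (l - measure lebesgue J) + \<tau> * measure lebesgue J = fragment_cost \<tau> l J"
    by (simp add: fragment_cost_def algebra_simps)
  finally have int: "curve_integral L \<gamma> (\<lambda>z. \<tau> + indicator U z) = ennreal (fragment_cost \<tau> l J)" .
  have "\<gamma> 0 \<in> X" "\<gamma> L \<in> X" using rect by (auto simp: rectifiable_curve_def image_subset_iff)
  then have "\<bar>fragment_dist X U \<tau> x (\<gamma> 0) - fragment_dist X U \<tau> x (\<gamma> L)\<bar> \<le> fragment_cost \<tau> l J"
    using fragment_dist_triangle[OF _ forward] fragment_dist_triangle[OF _ backward] J'(2)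
    by (simp add: fragment_cost_def abs_le_iff)
  then show "ennreal \<bar>fragment_dist X U \<tau> x (\<gamma> 0) - fragment_dist X U \<tau> x (\<gamma> L)\<bar>
      \<le> curve_integral L \<gamma> (\<lambda>z. \<tau> + indicator U z)"
    unfolding int by (rule ennreal_leI)
qed

end

section \<open>Averages and mean oscillation\<close>
lemma set_integrable_bounded:
  fixes u :: "'a \<Rightarrow> real"
  assumes "A \<in> fmeasurable \<mu>" "u \<in> borel_measurable \<mu>" "\<And>z. z \<in> A \<Longrightarrow> \<bar>u z\<bar> \<le> M"
  shows "set_integrable \<mu> A u"
  unfolding set_integrable_def
proof (rule integrableI_bounded_set[where A = A and B = M])
  show "AE z in \<mu>. z \<in> A \<longrightarrow> norm (indicat_real A z *\<^sub>R u z) \<le> M" using assms(3) by auto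
qed (use assms in \<open>auto simp: fmeasurable_def\<close>)

lemma set_integral_ge_const:
  fixes u :: "'a \<Rightarrow> real"
  assumes "A \<in> fmeasurable \<mu>" "set_integrable \<mu> A u" "\<And>z. z \<in> A \<Longrightarrow> c \<le> u z"
  shows "c * measure \<mu> A \<le> (LINT z:A|\<mu>. u z)"
proof -
  have "c * measure \<mu> A = (LINT z:A|\<mu>. c)"
    using assms(1) by (simp add: set_lebesgue_integral_def fmeasurable_def mult.commute)
  also have "\<dots> \<le> (LINT z:A|\<mu>. u z)"
    using assms by (intro set_integral_mono) (auto simp: set_integrable_def fmeasurable_def)
  finally show ?thesis .
qed

lemma set_integral_mono_domain:
  fixes u :: "'a \<Rightarrow> real"
  assumes "\<And>z. 0 \<le> u z" "set_integrable \<mu> B u" "A \<in> sets \<mu>" "A \<subseteq> B"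
  shows "(LINT z:A|\<mu>. u z) \<le> (LINT z:B|\<mu>. u z)"
  using assms set_integrable_subset[OF assms(2-4)]
  unfolding set_lebesgue_integral_def set_integrable_def
  by (intro integral_mono) (auto simp: indicator_def)

lemma avg_const_plus_indicator:
  assumes "A \<in> fmeasurable \<mu>" "U \<in> sets \<mu>" "0 < measure \<mu> A"
  shows "avg \<mu> A (\<lambda>z. a + b * indicator U z) = a + b * (measure \<mu> (U \<inter> A) / measure \<mu> A)"
proof -
  have fin: "A \<in> sets \<mu>" "emeasure \<mu> A < \<infinity>" using assms by (auto simp: fmeasurable_def)
  have fin': "emeasure \<mu> (U \<inter> A) < \<infinity>"
    using emeasure_mono[of "U \<inter> A" A \<mu>] fin by (auto intro: le_less_trans)
  have "(LINT z:A|\<mu>. a + b * indicator U z)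
     = (LINT z|\<mu>. a * indicator A z + b * indicator (U \<inter> A) z)"
    unfolding set_lebesgue_integral_def
    by (intro Bochner_Integration.integral_cong) (auto simp: indicator_def)
  also have "\<dots> = a * measure \<mu> A + b * measure \<mu> (U \<inter> A)"
    using fin fin' assms(2) by (subst Bochner_Integration.integral_add) (auto simp: sets.Int)
  finally show ?thesis using assms(3) by (simp add: avg_def field_simps)
qed

lemma avg_le:
  assumes "A \<in> fmeasurable \<mu>" "0 < measure \<mu> A" "set_integrable \<mu> A u" "\<And>z. z \<in> A \<Longrightarrow> u z \<le> M"
  shows "avg \<mu> A u \<le> M"
proof -
  have "(LINT z:A|\<mu>. u z) \<le> (LINT z:A|\<mu>. M)"
    using assms by (intro set_integral_mono) (auto simp: set_integrable_def fmeasurable_def)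
  also have "\<dots> = M * measure \<mu> A"
    using assms by (simp add: set_lebesgue_integral_def fmeasurable_def mult.commute)
  finally show ?thesis using assms(2) by (simp add: avg_def field_simps)
qed

lemma le_avg:
  assumes "A \<in> fmeasurable \<mu>" "0 < measure \<mu> A" "set_integrable \<mu> A u" "\<And>z. z \<in> A \<Longrightarrow> M \<le> u z"
  shows "M \<le> avg \<mu> A u"
  using set_integral_ge_const[OF assms(1,3,4)] assms(2) by (simp add: avg_def field_simps)

lemma set_integrable_abs_diff_const:
  fixes u :: "'a \<Rightarrow> real"
  assumes "A \<in> fmeasurable \<mu>" "set_integrable \<mu> A u"
  shows "set_integrable \<mu> A (\<lambda>z. \<bar>u z - c\<bar>)"
proof -
  have "set_integrable \<mu> A (\<lambda>_. c)"
    using assms(1) by (auto simp: set_integrable_def fmeasurable_def)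
  then show ?thesis using assms(2) by (intro set_integrable_abs set_integral_diff(1))
qed

lemma mean_oscillation_le_oscillation:
  assumes A: "A \<in> fmeasurable \<mu>" "0 < measure \<mu> A" and u: "set_integrable \<mu> A u"
    and osc: "\<And>z. z \<in> A \<Longrightarrow> \<bar>u z - c\<bar> \<le> b"
  shows "mean_oscillation \<mu> A u \<le> 2 * b"
proof -
  have "c - b \<le> avg \<mu> A u" "avg \<mu> A u \<le> c + b"
    using osc by (intro avg_le le_avg A u; force simp: abs_le_iff)+
  then have "\<bar>u z - avg \<mu> A u\<bar> \<le> 2 * b" if "z \<in> A" for z
    using osc[OF that] by (auto simp: abs_le_iff)
  then show ?thesis
    unfolding mean_oscillation_def using A u
    by (intro avg_le set_integrable_abs_diff_const) auto
qed

text \<open>By Chebyshev's inequality the set where \<open>u\<close> is farther than \<open>M h\<close> from its mean is too small to contain \<open>A\<close>.\<close>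
lemma near_average_somewhere:
  assumes B: "B \<in> fmeasurable \<mu>" and A: "A \<in> sets \<mu>" "A \<subseteq> B" "0 < measure \<mu> A"
    and M: "measure \<mu> B \<le> M * measure \<mu> A"
    and u: "set_integrable \<mu> B u" and h: "mean_oscillation \<mu> B u < h"
  shows "\<exists>w\<in>A. \<bar>u w - avg \<mu> B u\<bar> \<le> M * h"
proof (rule ccontr)
  assume "\<not> ?thesis"
  then have big: "M * h \<le> \<bar>u w - avg \<mu> B u\<bar>" if "w \<in> A" for w using that by force
  let ?v = "\<lambda>w. \<bar>u w - avg \<mu> B u\<bar>"
  have Af: "A \<in> fmeasurable \<mu>" using A B by (blast intro: fmeasurableI2)
  have vB: "set_integrable \<mu> B ?v" using B u by (rule set_integrable_abs_diff_const)
  have vA: "set_integrable \<mu> A ?v" using vB A(1,2) by (rule set_integrable_subset)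
  have pos: "0 < measure \<mu> B"
    using A B measure_mono_fmeasurable[of A B \<mu>] by auto
  have hpos: "0 < h"
  proof -
    have "0 \<le> mean_oscillation \<mu> B u"
      unfolding mean_oscillation_def using B pos vB by (intro le_avg) auto
    with h show ?thesis by simp
  qed
  have "h * measure \<mu> B \<le> h * (M * measure \<mu> A)"
    using M hpos by (intro mult_left_mono) auto
  also have "\<dots> = (M * h) * measure \<mu> A" by simp
  also have "\<dots> \<le> avg \<mu> A ?v * measure \<mu> A"
    using le_avg[OF Af A(3) vA big] by (intro mult_right_mono) auto
  also have "\<dots> = (LINT w:A|\<mu>. ?v w)" using A(3) by (simp add: avg_def)
  also have "\<dots> \<le> (LINT w:B|\<mu>. ?v w)"
    using vB A(1,2) by (intro set_integral_mono_domain) auto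
  also have "\<dots> = mean_oscillation \<mu> B u * measure \<mu> B"
    using pos by (simp add: mean_oscillation_def avg_def)
  also have "\<dots> < h * measure \<mu> B" using h pos by simp
  finally show False by simp
qed

section \<open>Doubling spaces\<close>

text \<open>The bound \<open>D \<ge> 1\<close> costs no generality, since the doubling constant may be increased.\<close>
locale doubling_space =
  fixes X :: "'a::metric_space set" and \<mu> :: "'a measure" and D :: real and r0 :: ereal
  assumes mms: "metric_measure_space X \<mu>" and dbl: "doubling D r0 X \<mu>" and D: "1 \<le> D"
begin

lemma sets_eq: "sets \<mu> = sets (restrict_space borel X)"
  using mms by (simp add: metric_measure_space_def radon_measure_on_def)

lemma space_eq: "space \<mu> = X"
  using sets_eq_imp_space_eq[OF sets_eq] by (simp add: space_restrict_space)

lemma openin_in_sets: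
  assumes "openin (top_of_set X) U" shows "U \<in> sets \<mu>"
proof -
  obtain V where "open V" "U = X \<inter> V" using assms by (auto simp: openin_open)
  then show ?thesis unfolding sets_eq sets_restrict_space by simp
qed

lemma compact_in_sets:
  assumes "compact K" "K \<subseteq> X" shows "K \<in> sets \<mu>"
proof -
  have "K = X \<inter> K" using assms by blast
  then show ?thesis unfolding sets_eq sets_restrict_space using borel_compact[OF assms(1)] by blast
qed

lemma inner_regular:
  "A \<in> sets \<mu> \<Longrightarrow> emeasure \<mu> A = (SUP K\<in>{K. compact K \<and> K \<subseteq> A}. emeasure \<mu> K)"
  using mms by (simp add: metric_measure_space_def radon_measure_on_def)

lemma ball_fmeasurable: "x \<in> X \<Longrightarrow> X \<inter> ball x r \<in> fmeasurable \<mu>"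
proof (cases "r > 0")
  case True
  assume "x \<in> X"
  then show ?thesis
    using mms True openin_in_sets[of "X \<inter> ball x r"]
    by (auto simp: metric_measure_space_def fmeasurable_def openin_open)
qed (auto simp: ball_empty)

lemma ball_pos: "x \<in> X \<Longrightarrow> 0 < r \<Longrightarrow> 0 < measure \<mu> (X \<inter> ball x r)"
  using mms ball_fmeasurable[of x r]
  by (auto simp: metric_measure_space_def measure_def enn2real_positive_iff)

lemma ball_mono:
  assumes "x \<in> X" "y \<in> X" "dist x y + s \<le> r"
  shows "measure \<mu> (X \<inter> ball y s) \<le> measure \<mu> (X \<inter> ball x r)"
proof (rule measure_mono_fmeasurable)
  show "X \<inter> ball y s \<subseteq> X \<inter> ball x r"
  proof
    fix z assume "z \<in> X \<inter> ball y s"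
    then show "z \<in> X \<inter> ball x r" using dist_triangle[of x z y] assms(3) by auto
  qed
qed (use assms ball_fmeasurable in \<open>auto dest: fmeasurableD\<close>)

lemma doubling_power:
  assumes "x \<in> X" "0 < r" "ereal (2 ^ k * r) < r0"
  shows "measure \<mu> (X \<inter> ball x (2 ^ k * r)) \<le> D ^ k * measure \<mu> (X \<inter> ball x r)"
  using assms(3)
proof (induction k)
  case (Suc k)
  have "2 ^ k * r \<le> 2 ^ Suc k * r" using assms(2) by simp
  then have lt: "ereal (2 ^ k * r) < r0"
    using Suc.prems by (meson ereal_less_eq(3) le_less_trans)
  have "measure \<mu> (X \<inter> ball x (2 * (2 ^ k * r))) \<le> D * measure \<mu> (X \<inter> ball x (2 ^ k * r))"
    using dbl assms lt by (simp add: doubling_def)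
  also have "\<dots> \<le> D * (D ^ k * measure \<mu> (X \<inter> ball x r))"
    using Suc.IH[OF lt] D by (intro mult_left_mono) auto
  finally show ?case by (simp add: mult.assoc)
qed simp

lemma doubling_le:
  assumes "x \<in> X" "y \<in> X" "0 < r" "dist x y + s \<le> 2 ^ k * r" "ereal (2 ^ k * r) < r0"
  shows "measure \<mu> (X \<inter> ball y s) \<le> D ^ k * measure \<mu> (X \<inter> ball x r)"
  using ball_mono[OF assms(1,2,4)] doubling_power[OF assms(1,3,5)] by simp

lemma lipschitz_measurable:
  assumes "L-lipschitz_on X f" shows "f \<in> borel_measurable \<mu>"
  using borel_measurable_continuous_on_restrict[OF lipschitz_on_continuous_on[OF assms]]
  by (simp cong: measurable_cong_sets add: sets_eq)

lemma lipschitz_set_integrable: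
  fixes f :: "'a \<Rightarrow> real"
  assumes "L-lipschitz_on X f" "x \<in> X"
  shows "set_integrable \<mu> (X \<inter> ball x r) f"
proof (rule set_integrable_bounded)
  show "\<bar>f z\<bar> \<le> \<bar>f x\<bar> + L * r" if "z \<in> X \<inter> ball x r" for z
  proof -
    have "\<bar>f x - f z\<bar> \<le> L * dist x z"
      using lipschitz_onD[OF assms(1), of x z] that assms(2) by (auto simp: dist_real_def)
    also have "\<dots> \<le> L * r"
      using that lipschitz_on_nonneg[OF assms(1)] by (intro mult_left_mono) auto
    finally show ?thesis by linarith
  qed
qed (use assms ball_fmeasurable lipschitz_measurable in auto)

end

section \<open>Fragments that avoid a set of small density\<close>

text \<open>The conclusion of \<^const>\<open>connected_pair\<close> for one set \<open>E\<close>, in a normalized form: \<open>\<gamma>\<close> has unit speed, so its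
length is at most \<open>T\<close> and its gaps are measured by \<open>T - |K|\<close>.\<close>
definition joined_by_fragment ::
  "'a::metric_space set \<Rightarrow> 'a set \<Rightarrow> real \<Rightarrow> real \<Rightarrow> 'a \<Rightarrow> 'a \<Rightarrow> bool" where
  "joined_by_fragment X E C \<delta> x y \<longleftrightarrow>
     (\<exists>T K \<gamma>. 0 < T \<and> T \<le> C * dist x y \<and> compact K \<and> K \<subseteq> {0..T} \<and> 0 \<in> K \<and> T \<in> K \<and>
        1-lipschitz_on K \<gamma> \<and> \<gamma> ` K \<subseteq> X \<and> \<gamma> 0 = x \<and> \<gamma> T = y \<and>
        T - measure lebesgue K < \<delta> * dist x y \<and> (\<forall>t\<in>K. 0 < t \<and> t < T \<longrightarrow> \<gamma> t \<notin> E))"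

text \<open>The fragment distance \<open>F\<close> from \<open>x\<close> is small at \<open>y\<close>. The hypotheses record the choice of constants in the order in
which they are made:
\<open>\<kappa>\<close> is the relative radius of the balls around \<open>x\<close> and \<open>y\<close> on which \<open>F\<close> varies by little;
\<open>k\<close> counts the doublings that lead from these balls to \<open>B(x,2d)\<close>;
\<open>\<eta>\<close> is the admissible mean oscillation, and \<open>s\<close> the size of the average of \<open>\<Phi> \<circ> g\<close> that guarantees it;
\<open>\<tau>\<close> and the density \<open>\<epsilon>\<close> each contribute at most \<open>s/2\<close> to that average;
\<open>Cb\<close> is large enough for fragments of cost \<open>\<delta> d\<close> to stay in \<open>B(x, Cb d)\<close>, and \<open>m\<close> counts the doublings
that compare this ball with the ball \<open>B(x, 2 C d)\<close> of the Poincare inequality.\<close>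
lemma (in doubling_space) joined_by_fragment_if_small_density:
  assumes np: "nonhomogeneous_Poincare \<Phi> \<Psi> C r0 X \<mu>" and C: "0 < C"
    and \<Phi>: "increasing_modulus \<Phi>"
    and \<kappa>: "0 < \<kappa>" "\<kappa> < 1" "16 * \<kappa> \<le> \<delta>" "4 \<le> 2 ^ k * \<kappa>"
    and \<eta>: "\<And>t. 0 \<le> t \<Longrightarrow> t \<le> s \<Longrightarrow> \<Psi> t < \<eta>" "16 * D ^ k * \<eta> \<le> \<delta>"
    and \<tau>: "0 < \<tau>" "\<tau> \<le> 1" "2 * \<Phi> \<tau> \<le> s"
    and \<theta>: "2 * \<Phi> 2 * (\<epsilon> * D ^ m) \<le> s"
    and Cb: "2 * C \<le> Cb" "\<delta> \<le> \<tau> * Cb" "Cb \<le> 2 ^ m * (2 * C)"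
    and M: "2 ^ k * \<kappa> \<le> M" "2 ^ m * (2 * C) \<le> M"
    and \<delta>: "0 < \<delta>" and \<epsilon>: "0 < \<epsilon>" "\<epsilon> < 1"
    and xy: "x \<in> X" "y \<in> X" "0 < dist x y" "ereal (M * dist x y) < r0"
    and E: "E \<in> sets \<mu>"
      "measure \<mu> (E \<inter> ball x (Cb * dist x y)) < \<epsilon> * measure \<mu> (X \<inter> ball x (Cb * dist x y))"
  shows "joined_by_fragment X E Cb \<delta> x y"
proof -
  define d where "d = dist x y"
  note d = xy(3,4)[folded d_def]
  have scale: "ereal (a * d) < r0" if "a \<le> M" for a
  proof -
    have "a * d \<le> M * d" using that d by (intro mult_right_mono) auto
    then show ?thesis using d(2) by (meson ereal_less_eq(3) le_less_trans)
  qed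
  define B0 where "B0 = X \<inter> ball x (Cb * d)"
  have Cbpos: "0 < Cb" using C Cb by linarith
  have B0: "B0 \<in> fmeasurable \<mu>" "0 < measure \<mu> B0"
    unfolding B0_def using ball_fmeasurable ball_pos xy(1) d Cbpos by auto
  have EB: "E \<inter> ball x (Cb * d) = E \<inter> B0"
    using sets.sets_into_space[OF E(1)] by (auto simp: B0_def space_eq)
  have Ef: "E \<inter> B0 \<in> fmeasurable \<mu>"
    using fmeasurable_Int_fmeasurable[OF B0(1) E(1)] by (simp add: Int_commute)
  have "measure \<mu> (B0 - E) = measure \<mu> B0 - measure \<mu> (E \<inter> B0)"
    using measurable_measure_Diff[OF B0(1), of "E \<inter> B0"] Ef by (auto simp: Diff_Int)
  then have "(1 - \<epsilon>) * measure \<mu> B0 < measure \<mu> (B0 - E)"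
    using E(2) EB by (simp add: B0_def d_def algebra_simps)
  moreover have "B0 - E \<in> fmeasurable \<mu>" using B0 E by (intro fmeasurable_Diff) auto
  then have "emeasure \<mu> (B0 - E) = ennreal (measure \<mu> (B0 - E))" by (rule emeasure_eq_measure2)
  \<comment> \<open>Inner regularity of the complement provides the open set \<open>U\<close>: it is the ball minus a compact set that misses \<open>E\<close>.\<close>
  ultimately have "ennreal ((1 - \<epsilon>) * measure \<mu> B0) < emeasure \<mu> (B0 - E)"
    using \<epsilon> B0(2) by (simp add: ennreal_less_iff)
  then obtain Q where Q: "compact Q" "Q \<subseteq> B0 - E" "ennreal ((1 - \<epsilon>) * measure \<mu> B0) < emeasure \<mu> Q"
  proof -
    have "B0 - E \<in> sets \<mu>" using \<open>B0 - E \<in> fmeasurable \<mu>\<close> by (rule fmeasurableD)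
    then have "ennreal ((1 - \<epsilon>) * measure \<mu> B0) < (SUP K\<in>{K. compact K \<and> K \<subseteq> B0 - E}. emeasure \<mu> K)"
      using \<open>ennreal _ < emeasure \<mu> (B0 - E)\<close> by (simp only: inner_regular)
    then show ?thesis unfolding less_SUP_iff using that by blast
  qed
  have Qf: "Q \<in> fmeasurable \<mu>"
  proof (rule fmeasurableI2[OF B0(1)])
    show "Q \<subseteq> B0" using Q(2) by blast
    then show "Q \<in> sets \<mu>" using Q(1) by (intro compact_in_sets) (auto simp: B0_def)
  qed
  have mQ: "(1 - \<epsilon>) * measure \<mu> B0 < measure \<mu> Q"
    using Q(3) \<epsilon> emeasure_eq_measure2[OF Qf] by (simp add: ennreal_less_iff)
  define U where "U = B0 - Q"
  have U_open: "openin (top_of_set X) U"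
  proof -
    have "U = X \<inter> (ball x (Cb * d) - Q)" by (auto simp: U_def B0_def)
    moreover have "open (ball x (Cb * d) - Q)" using compact_imp_closed[OF Q(1)] by (intro open_Diff) auto
    ultimately show ?thesis by (auto simp: openin_open)
  qed
  have U: "U \<in> sets \<mu>" using U_open by (rule openin_in_sets)
  have "measure \<mu> U = measure \<mu> B0 - measure \<mu> Q"
    unfolding U_def using measurable_measure_Diff[OF B0(1) fmeasurableD[OF Qf]] Q(2) by blast
  then have mU: "measure \<mu> U < \<epsilon> * measure \<mu> B0"
    using mQ by (simp add: algebra_simps)

  \<comment> \<open>The function to which the Poincare inequality is applied, and its upper gradient.\<close>
  define F where "F = fragment_dist X U \<tau> x"
  define g where "g = (\<lambda>z. \<tau> + indicator U z :: real)"
  have \<tau>0: "0 \<le> \<tau>" using \<tau> by simp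
  have F_lip: "2-lipschitz_on X F"
    unfolding F_def using lipschitz_on_le[OF fragment_dist_lipschitz[OF \<tau>0 xy(1)]] \<tau>(2) by simp
  have F_ug: "upper_gradient X F g"
    unfolding F_def g_def using fragment_dist_upper_gradient[OF \<tau>0 xy(1) U_open] .

  define B1 where "B1 = X \<inter> ball x (C * (2 * d))"
  have B1: "B1 \<in> fmeasurable \<mu>" "0 < measure \<mu> B1"
    unfolding B1_def using ball_fmeasurable ball_pos xy(1) d C by auto
  have mono: "\<Phi> a \<le> \<Phi> b" if "0 \<le> a" "a \<le> b" for a b
    using \<Phi> that by (auto simp: increasing_modulus_def mono_on_def)
  have nonneg: "0 \<le> \<Phi> a" if "0 \<le> a" for a using \<Phi> that by (simp add: increasing_modulus_def)
  have \<Phi>g: "(\<Phi> \<circ> g) = (\<lambda>z. \<Phi> \<tau> + (\<Phi> (1 + \<tau>) - \<Phi> \<tau>) * indicator U z)"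
    by (auto simp: g_def indicator_def add.commute)
  define p where "p = measure \<mu> (U \<inter> B1) / measure \<mu> B1"
  have p: "0 \<le> p" "p \<le> \<epsilon> * D ^ m"
  proof -
    have "measure \<mu> (U \<inter> B1) \<le> measure \<mu> U"
    proof (rule measure_mono_fmeasurable)
      show "U \<inter> B1 \<in> sets \<mu>" using U fmeasurableD[OF B1(1)] by (rule sets.Int)
      show "U \<in> fmeasurable \<mu>"
        by (rule fmeasurableI2[OF B0(1) _ U]) (auto simp: U_def)
    qed auto
    also have "\<dots> \<le> \<epsilon> * measure \<mu> B0" using mU by simp
    also have "measure \<mu> B0 \<le> D ^ m * measure \<mu> B1"
      unfolding B0_def B1_def
    proof (rule doubling_le)
      show "dist x x + Cb * d \<le> 2 ^ m * (C * (2 * d))"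
        using mult_right_mono[OF Cb(3), of d] d by (simp add: ac_simps)
      show "ereal (2 ^ m * (C * (2 * d))) < r0"
        using scale[OF M(2)] by (simp add: ac_simps)
    qed (use xy d C in auto)
    finally have "measure \<mu> (U \<inter> B1) \<le> \<epsilon> * (D ^ m * measure \<mu> B1)" using \<epsilon> by simp
    then show "p \<le> \<epsilon> * D ^ m" using B1(2) by (simp add: p_def field_simps)
    show "0 \<le> p" by (simp add: p_def)
  qed
  have avg_g: "avg \<mu> B1 (\<Phi> \<circ> g) = \<Phi> \<tau> + (\<Phi> (1 + \<tau>) - \<Phi> \<tau>) * p"
    unfolding \<Phi>g p_def by (rule avg_const_plus_indicator[OF B1(1) U B1(2)])
  have avg_g_bounds: "0 \<le> avg \<mu> B1 (\<Phi> \<circ> g)" "avg \<mu> B1 (\<Phi> \<circ> g) \<le> s"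
  proof -
    show "0 \<le> avg \<mu> B1 (\<Phi> \<circ> g)"
      unfolding avg_g using p(1) nonneg[OF \<tau>0] mono[of \<tau> "1 + \<tau>"] \<tau>0 by simp
    have "(\<Phi> (1 + \<tau>) - \<Phi> \<tau>) * p \<le> \<Phi> 2 * p"
      using mono[of "1 + \<tau>" 2] nonneg[OF \<tau>0] \<tau> p(1) by (intro mult_right_mono) auto
    also have "\<dots> \<le> \<Phi> 2 * (\<epsilon> * D ^ m)"
      using p(2) nonneg[of 2] by (intro mult_left_mono) auto
    finally show "avg \<mu> B1 (\<Phi> \<circ> g) \<le> s" unfolding avg_g using \<theta> \<tau>(3) by simp
  qed
  have \<Phi>g_int: "set_integrable \<mu> B1 (\<Phi> \<circ> g)"
  proof (rule set_integrable_bounded[OF B1(1)])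
    show "\<Phi> \<circ> g \<in> borel_measurable \<mu>" unfolding \<Phi>g using U by measurable
    show "\<bar>(\<Phi> \<circ> g) z\<bar> \<le> \<Phi> 2" for z
      using mono[of "1 + \<tau>" 2] mono[of \<tau> 2] nonneg[of \<tau>] nonneg[of "1 + \<tau>"] \<tau>
      by (auto simp: \<Phi>g indicator_def)
  qed

  define h where "h = 2 * d * \<eta>"
  define B where "B = X \<inter> ball x (2 * d)"
  have B: "B \<in> fmeasurable \<mu>" unfolding B_def using ball_fmeasurable xy(1) by auto
  have "2 \<le> M"
  proof -
    have "2 ^ k * \<kappa> \<le> M" by (rule M)
    then show ?thesis using \<kappa>(4) by linarith
  qed
  then have "ereal (2 * d) < r0" by (rule scale)
  then have "mean_oscillation \<mu> B F \<le> 2 * d * \<Psi> (avg \<mu> B1 (\<Phi> \<circ> g))"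
    using np F_lip F_ug \<Phi>g_int xy(1) d(1) unfolding nonhomogeneous_Poincare_def B_def B1_def by force
  also have "\<dots> < h" unfolding h_def using \<eta>(1)[OF avg_g_bounds] d(1) by simp
  finally have osc: "mean_oscillation \<mu> B F < h" .
  \<comment> \<open>Near both \<open>x\<close> and \<open>y\<close> the function \<open>F\<close> comes close to its mean over \<open>B\<close>.\<close>
  have near: "\<exists>w\<in>X \<inter> ball q (\<kappa> * d). \<bar>F w - avg \<mu> B F\<bar> \<le> D ^ k * h"
    if q: "q \<in> X" "dist x q \<le> d" for q
  proof (rule near_average_somewhere[OF B _ _ _ _ _ osc])
    have \<kappa>d: "0 < \<kappa> * d" "\<kappa> * d < d" using \<kappa> d by auto
    show "X \<inter> ball q (\<kappa> * d) \<in> sets \<mu>" using ball_fmeasurable[OF q(1)] by (rule fmeasurableD)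
    show "X \<inter> ball q (\<kappa> * d) \<subseteq> B"
    proof
      fix z assume "z \<in> X \<inter> ball q (\<kappa> * d)"
      then show "z \<in> B" using dist_triangle[of x z q] q(2) \<kappa>d by (auto simp: B_def)
    qed
    show "0 < measure \<mu> (X \<inter> ball q (\<kappa> * d))" using ball_pos q(1) \<kappa>d by simp
    show "set_integrable \<mu> B F"
      unfolding B_def using F_lip xy(1) by (rule lipschitz_set_integrable)
    show "measure \<mu> B \<le> D ^ k * measure \<mu> (X \<inter> ball q (\<kappa> * d))"
      unfolding B_def
    proof (rule doubling_le)
      have "4 * d \<le> 2 ^ k * (\<kappa> * d)"
        using mult_right_mono[OF \<kappa>(4), of d] d(1) by (simp only: mult.assoc)
      then show "dist q x + 2 * d \<le> 2 ^ k * (\<kappa> * d)"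
        using q(2) d(1) unfolding dist_commute[of q x] by linarith
      show "ereal (2 ^ k * (\<kappa> * d)) < r0" using scale[OF M(1)] by (simp add: ac_simps)
    qed (use xy q \<kappa>d in auto)
  qed
  obtain v where v: "v \<in> X \<inter> ball x (\<kappa> * d)" "\<bar>F v - avg \<mu> B F\<bar> \<le> D ^ k * h"
    using near[of x] xy d(1) by auto
  obtain w where w: "w \<in> X \<inter> ball y (\<kappa> * d)" "\<bar>F w - avg \<mu> B F\<bar> \<le> D ^ k * h"
    using near[of y] xy by (auto simp: d_def)
  have F_near: "\<bar>F q - F z\<bar> \<le> 2 * (\<kappa> * d)" if "q \<in> X" "z \<in> X \<inter> ball q (\<kappa> * d)" for q z
  proof -
    have "\<bar>F q - F z\<bar> \<le> 2 * dist q z"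
      using lipschitz_onD[OF F_lip, of q z] that by (auto simp: dist_real_def)
    then show ?thesis using that by auto
  qed
  have "F y \<le> 4 * (\<kappa> * d) + 2 * (D ^ k * h)"
    using F_near[OF xy(1) v(1)] F_near[OF xy(2) w(1)] v(2) w(2) fragment_dist_self[OF \<tau>0 xy(1), of U]
    unfolding F_def by (simp only: abs_le_iff) linarith
  also have "\<dots> \<le> (\<delta> / 4) * d + (\<delta> / 4) * d"
  proof (rule add_mono)
    show "4 * (\<kappa> * d) \<le> (\<delta> / 4) * d"
      using mult_right_mono[OF \<kappa>(3), of d] d(1) by (simp add: field_simps)
    show "2 * (D ^ k * h) \<le> (\<delta> / 4) * d"
      using mult_right_mono[OF \<eta>(2), of d] d(1) by (simp add: h_def field_simps)
  qed
  also have "\<dots> < \<delta> * d" using \<delta> d(1) by simp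
  finally have "F y < \<delta> * d" .
  then obtain T K' \<gamma> where f: "unit_fragment X U x y T K' \<gamma>" "fragment_cost \<tau> T K' < \<delta> * d"
    using fragment_dist_less[OF \<tau>0 xy(1,2)] unfolding F_def by blast
  note f' = f(1)[unfolded unit_fragment_def]
  define K where "K = insert 0 (insert T K')"
  have lip: "1-lipschitz_on K \<gamma>" and KX: "\<gamma> ` K \<subseteq> X" using f' by (auto simp only: K_def)
  \<comment> \<open>The term \<open>\<tau> T\<close> of the cost bounds the duration, hence keeps the fragment inside the ball \<open>B0\<close>.\<close>
  have "\<tau> * T < \<delta> * d" using fragment_cost_ge[OF f(1), of \<tau>] f(2) by simp
  also have "\<delta> * d \<le> \<tau> * (Cb * d)"
    using mult_right_mono[OF Cb(2), of d] d(1) by (simp add: ac_simps)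
  finally have T_less: "T < Cb * d" using \<tau>(1) by simp
  have "d \<le> T"
    using lipschitz_onD[OF lip, of 0 T] f' by (auto simp: K_def d_def)
  have K: "compact K" "K \<subseteq> {0..T}" "0 \<in> K" "T \<in> K"
    using f' by (auto simp: K_def)
  have "measure lebesgue K' \<le> measure lebesgue K"
    using f' K(1) by (intro measure_mono_fmeasurable) (auto simp: K_def lmeasurable_compact fmeasurableD)
  moreover have "0 \<le> \<tau> * T" using \<tau>0 f' by simp
  ultimately have "T - measure lebesgue K < \<delta> * d"
    using f(2) by (simp add: fragment_cost_def algebra_simps)
  moreover have "\<gamma> t \<notin> E" if t: "t \<in> K" "0 < t" "t < T" for t
  proof -
    have "t \<in> K'" using t by (auto simp: K_def)
    then have "\<gamma> t \<in> X" "\<gamma> t \<notin> U" using f' by auto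
    moreover have "dist x (\<gamma> t) \<le> t"
      using lipschitz_onD[OF lip K(3) t(1)] f' t(2) by simp
    ultimately show ?thesis using Q(2) t T_less by (auto simp: U_def B0_def)
  qed
  moreover have "0 < T" using \<open>d \<le> T\<close> d(1) by simp
  ultimately show ?thesis
    unfolding joined_by_fragment_def using K lip KX f' T_less
    by (intro exI[of _ T] exI[of _ K] exI[of _ \<gamma>]) (auto simp: d_def)
qed

text \<open>The constants depend on \<open>C\<close>, \<open>\<Phi>\<close>, \<open>\<Psi>\<close>, \<open>D\<close> and \<open>\<delta>\<close> only: neither on the space nor on \<open>r0\<close>, which enters
through the restriction \<open>M d(x,y) < r0\<close>. For \<open>r0 = \<infinity>\<close> the statement is therefore global.\<close>
lemma joined_by_fragment_constants:
  fixes D C \<delta> :: real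
  assumes C: "0 < C" and \<Phi>: "increasing_modulus \<Phi>" and \<Psi>: "increasing_modulus \<Psi>"
    and D: "1 \<le> D" and \<delta>: "0 < \<delta>" "\<delta> < 1"
  shows "\<exists>Cb \<epsilon> M :: real. 1 \<le> Cb \<and> 0 < \<epsilon> \<and> \<epsilon> < 1 \<and> 0 < M \<and>
    (\<forall>(X :: 'a::metric_space set) \<mu> r0 E x y.
       doubling_space X \<mu> D r0 \<and> nonhomogeneous_Poincare \<Phi> \<Psi> C r0 X \<mu> \<and>
       x \<in> X \<and> y \<in> X \<and> 0 < dist x y \<and> ereal (M * dist x y) < r0 \<and> E \<in> sets \<mu> \<and>
       measure \<mu> (E \<inter> ball x (Cb * dist x y)) < \<epsilon> * measure \<mu> (X \<inter> ball x (Cb * dist x y))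
       \<longrightarrow> joined_by_fragment X E Cb \<delta> x y)"
proof -
  have small: "\<exists>b>0. \<forall>t. 0 \<le> t \<and> t \<le> b \<longrightarrow> F t < c" if "increasing_modulus F" "0 < c" for F c
  proof -
    have "eventually (\<lambda>t. F t < c) (at_right 0)"
      using that order_tendstoD(2) unfolding increasing_modulus_def by blast
    then obtain b where b: "b > 0" "\<And>t. 0 < t \<Longrightarrow> t < b \<Longrightarrow> F t < c"
      unfolding eventually_at_right_field by auto
    have "F t < c" if "0 \<le> t" "t \<le> b / 2" for t
      using b that \<open>increasing_modulus F\<close> \<open>0 < c\<close>
      by (cases "t = 0") (auto simp: increasing_modulus_def)
    then show ?thesis using b(1) by (intro exI[of _ "b / 2"]) auto
  qed
  have pow: "\<exists>n. a \<le> 2 ^ n" for a :: real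
    using real_arch_pow[of 2 a] by (auto intro: less_imp_le)
  define \<kappa> where "\<kappa> = \<delta> / 16"
  obtain k where k: "4 / \<kappa> \<le> 2 ^ k" using pow by blast
  define \<eta> where "\<eta> = \<delta> / (16 * D ^ k)"
  have "0 < \<eta>" using \<delta> D by (simp add: \<eta>_def)
  obtain s where s: "s > 0" "\<And>t. 0 \<le> t \<Longrightarrow> t \<le> s \<Longrightarrow> \<Psi> t < \<eta>"
    using small[OF \<Psi> \<open>0 < \<eta>\<close>] by auto
  obtain b where b: "b > 0" "\<And>t. 0 \<le> t \<Longrightarrow> t \<le> b \<Longrightarrow> \<Phi> t < s / 2"
    using small[OF \<Phi>, of "s / 2"] s(1) by auto
  define \<tau> where "\<tau> = min 1 b"
  have \<tau>: "0 < \<tau>" "\<tau> \<le> 1" "2 * \<Phi> \<tau> \<le> s"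
    using b(1) b(2)[of \<tau>] by (auto simp: \<tau>_def)
  define Cb where "Cb = max 1 (max (2 * C) (\<delta> / \<tau>))"
  obtain m where m: "Cb / (2 * C) \<le> 2 ^ m" using pow by blast
  have \<Phi>2: "0 \<le> \<Phi> 2" using \<Phi> by (simp add: increasing_modulus_def)
  define \<epsilon> where "\<epsilon> = min (1 / 2) (s / (2 * (\<Phi> 2 + 1) * D ^ m))"
  have \<epsilon>: "0 < \<epsilon>" "\<epsilon> < 1" using s(1) \<Phi>2 D by (auto simp: \<epsilon>_def)
  define M where "M = max (2 ^ k * \<kappa>) (2 ^ m * (2 * C))"
  have "joined_by_fragment X E Cb \<delta> x y"
    if a: "doubling_space X \<mu> D r0" "nonhomogeneous_Poincare \<Phi> \<Psi> C r0 X \<mu>"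
       "x \<in> X" "y \<in> X" "0 < dist x y" "ereal (M * dist x y) < r0" "E \<in> sets \<mu>"
       "measure \<mu> (E \<inter> ball x (Cb * dist x y)) < \<epsilon> * measure \<mu> (X \<inter> ball x (Cb * dist x y))"
     for X :: "'a set" and \<mu> r0 E x y
  proof (rule doubling_space.joined_by_fragment_if_small_density
      [OF a(1,2) C \<Phi>, where \<kappa> = \<kappa> and k = k and s = s and \<eta> = \<eta> and \<tau> = \<tau> and m = m and \<epsilon> = \<epsilon> and M = M])
    show "0 < \<kappa>" "\<kappa> < 1" "16 * \<kappa> \<le> \<delta>" using \<delta> by (auto simp: \<kappa>_def)
    then show "4 \<le> 2 ^ k * \<kappa>" using k by (simp add: field_simps)
    show "16 * D ^ k * \<eta> \<le> \<delta>" using D by (simp add: \<eta>_def)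
    have "\<epsilon> * D ^ m \<le> s / (2 * (\<Phi> 2 + 1) * D ^ m) * D ^ m"
      using D by (intro mult_right_mono) (auto simp: \<epsilon>_def)
    also have "\<dots> = s / (2 * (\<Phi> 2 + 1))" using D by simp
    finally have "2 * \<Phi> 2 * (\<epsilon> * D ^ m) \<le> 2 * \<Phi> 2 * (s / (2 * (\<Phi> 2 + 1)))"
      using \<Phi>2 by (intro mult_left_mono) auto
    also have "\<dots> \<le> s" using \<Phi>2 s(1) by (simp add: field_simps)
    finally show "2 * \<Phi> 2 * (\<epsilon> * D ^ m) \<le> s" .
    show "2 * C \<le> Cb" by (simp add: Cb_def)
    have "\<delta> / \<tau> \<le> Cb" by (simp add: Cb_def)
    then show "\<delta> \<le> \<tau> * Cb" using \<tau>(1) by (simp add: field_simps)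
    show "Cb \<le> 2 ^ m * (2 * C)" using m C by (simp add: field_simps)
  qed (use a s \<tau> \<delta> \<epsilon> in \<open>auto simp: M_def\<close>)
  moreover have "0 < M" "1 \<le> Cb" using C by (auto simp: M_def Cb_def less_max_iff_disj)
  ultimately show ?thesis using \<epsilon>
    by (intro exI[of _ Cb] exI[of _ \<epsilon>] exI[of _ M]) blast
qed

lemma connected_pair_if_joined_by_fragment:
  assumes xy: "0 < dist x y"
    and joined: "\<And>E. E \<in> sets \<mu> \<Longrightarrow>
      measure \<mu> (E \<inter> ball x (C * dist x y)) < \<epsilon> * measure \<mu> (X \<inter> ball x (C * dist x y)) \<Longrightarrow>
      joined_by_fragment X E C \<delta> x y"
  shows "connected_pair C \<delta> \<epsilon> X \<mu> x y"
  unfolding connected_pair_def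
proof (intro ballI impI)
  fix E assume "E \<in> sets \<mu>"
    "measure \<mu> (E \<inter> ball x (C * dist x y)) < \<epsilon> * measure \<mu> (X \<inter> ball x (C * dist x y))"
  from joined[OF this] obtain T K \<gamma> where
    T: "0 < T" "T \<le> C * dist x y" and K: "compact K" "K \<subseteq> {0..T}" "0 \<in> K" "T \<in> K"
    and \<gamma>: "1-lipschitz_on K \<gamma>" "\<gamma> ` K \<subseteq> X" "\<gamma> 0 = x" "\<gamma> T = y"
    and gap: "T - measure lebesgue K < \<delta> * dist x y"
    and E: "\<And>t. t \<in> K \<Longrightarrow> 0 < t \<Longrightarrow> t < T \<Longrightarrow> \<gamma> t \<notin> E"
    unfolding joined_by_fragment_def by blast
  have ends: "Inf K = 0" "Sup K = T"
    using K by (auto intro!: cInf_eq_minimum cSup_eq_maximum)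
  have "curve_len K \<gamma> \<le> ennreal (T - 0)"
    using \<gamma>(1) K(2) T(1) by (intro curve_len_le_of_lipschitz) auto
  also have "\<dots> \<le> ennreal (C * dist x y)" using T(2) by (intro ennreal_leI) simp
  finally have len: "curve_len K \<gamma> \<le> ennreal (C * dist x y)" .
  have "measure lebesgue K \<le> measure lebesgue {0..T}"
    using K by (intro measure_mono_fmeasurable) (auto simp: lmeasurable_compact fmeasurableD)
  then have "ennreal (T - measure lebesgue K) < ennreal (\<delta> * dist x y)"
    using gap T(1) by (simp add: ennreal_less_iff)
  with gap_le_measure[OF K \<gamma>(1)] have "gap K \<gamma> < ennreal (\<delta> * dist x y)"
    by (rule le_less_trans)
  moreover have "{t \<in> K. \<gamma> t \<in> E} \<subseteq> {Inf K, Sup K}"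
  proof
    fix t assume "t \<in> {t \<in> K. \<gamma> t \<in> E}"
    then have t: "t \<in> K" "\<gamma> t \<in> E" "0 \<le> t" "t \<le> T" using K(2) by auto
    then have "t = 0 \<or> t = T" using E[OF t(1)] by linarith
    then show "t \<in> {Inf K, Sup K}" unfolding ends by blast
  qed
  moreover have "curve_fragment X K \<gamma>" "connects K \<gamma> x y"
    using K \<gamma> ends by (auto simp: curve_fragment_def connects_def)
  ultimately show "\<exists>K \<gamma>. curve_fragment X K \<gamma> \<and> connects K \<gamma> x y \<and>
      curve_len K \<gamma> \<le> ennreal (C * dist x y) \<and> gap K \<gamma> < ennreal (\<delta> * dist x y) \<and>
      {t \<in> K. \<gamma> t \<in> E} \<subseteq> {Inf K, Sup K}"
    using len by blast
qed

section \<open>The weak type inequality\<close>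

text \<open>Greedy selection: keep a ball of largest radius, discard the balls that meet it, which lie in its
threefold enlargement, and continue with the rest.\<close>
lemma finite_Vitali_covering:
  fixes \<rho> :: "'a::metric_space \<Rightarrow> real"
  assumes "finite I"
  shows "\<exists>J\<subseteq>I. disjoint_family_on (\<lambda>z. ball z (\<rho> z)) J \<and>
    (\<Union>z\<in>I. ball z (\<rho> z)) \<subseteq> (\<Union>z\<in>J. ball z (3 * \<rho> z))"
  using assms
proof (induction rule: finite_psubset_induct)
  case (psubset I)
  show ?case
  proof (cases "I = {}")
    case False
    then have "Max (\<rho> ` I) \<in> \<rho> ` I" using psubset.hyps by (intro Max_in) auto
    then obtain i where i: "i \<in> I" "\<rho> i = Max (\<rho> ` I)" by auto
    then have max: "\<rho> z \<le> \<rho> i" if "z \<in> I" for z using that psubset.hyps by simp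
    define I' where "I' = {z\<in>I. z \<noteq> i \<and> ball z (\<rho> z) \<inter> ball i (\<rho> i) = {}}"
    have "I' \<subset> I" using i(1) by (auto simp: I'_def)
    from psubset.IH[OF this] obtain J where J: "J \<subseteq> I'" "disjoint_family_on (\<lambda>z. ball z (\<rho> z)) J"
        "(\<Union>z\<in>I'. ball z (\<rho> z)) \<subseteq> (\<Union>z\<in>J. ball z (3 * \<rho> z))"
      by (elim exE conjE)
    have near: "ball z (\<rho> z) \<subseteq> ball i (3 * \<rho> i)" if z: "z \<in> I" "z \<notin> I'" for z
    proof
      fix w assume w: "w \<in> ball z (\<rho> z)"
      have \<rho>i: "dist z w < \<rho> i" using w max[OF z(1)] by simp
      have "dist i z < 2 * \<rho> i"
      proof (cases "z = i")
        case True
        moreover have "0 < \<rho> i" using \<rho>i zero_le_dist[of z w] by linarith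
        ultimately show ?thesis by simp
      next
        case False
        then obtain p where p: "p \<in> ball z (\<rho> z)" "p \<in> ball i (\<rho> i)"
          using z by (auto simp: I'_def)
        then show ?thesis
          using max[OF z(1)] dist_triangle[of i z p] by (simp add: dist_commute)
      qed
      then show "w \<in> ball i (3 * \<rho> i)" using \<rho>i dist_triangle[of i w z] by simp
    qed
    have "disjoint_family_on (\<lambda>z. ball z (\<rho> z)) (insert i J)"
      using J(1,2) unfolding disjoint_family_on_def I'_def by blast
    moreover have "insert i J \<subseteq> I" using J(1) i(1) by (auto simp: I'_def)
    moreover have "(\<Union>z\<in>I. ball z (\<rho> z)) \<subseteq> (\<Union>z\<in>insert i J. ball z (3 * \<rho> z))"
      using near J(3) by blast
    ultimately show ?thesis by blast
  qed (auto simp: disjoint_family_on_def)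
qed

text \<open>The centred maximal function of \<open>u\<close> at \<open>x\<close>, restricted to radii up to \<open>R\<close>, is at most \<open>t\<close>.\<close>
definition averages_le ::
  "'a::metric_space set \<Rightarrow> 'a measure \<Rightarrow> ('a \<Rightarrow> real) \<Rightarrow> 'a \<Rightarrow> real \<Rightarrow> real \<Rightarrow> bool" where
  "averages_le X \<mu> u x R t \<longleftrightarrow>
     (\<forall>\<rho>. 0 < \<rho> \<and> \<rho> \<le> R \<longrightarrow> (LINT z:X \<inter> ball x \<rho>|\<mu>. u z) \<le> t * measure \<mu> (X \<inter> ball x \<rho>))"

text \<open>The set \<open>Z\<close> need not be measurable; it is replaced by the union \<open>W\<close> of the balls that witness
\<open>z \<in> Z\<close>. Compact subsets of \<open>W\<close> are covered by finitely many of these balls, to which the finite covering lemma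
applies, and inner regularity carries the bound over to \<open>W\<close>.\<close>
lemma (in doubling_space) weak_type_estimate:
  assumes x0: "x0 \<in> X" and u: "\<And>z. 0 \<le> u z" "set_integrable \<mu> (X \<inter> ball x0 R0) u"
    and t: "0 < t" and R: "ereal (4 * R) < r0"
    and Z: "Z \<subseteq> X" "\<And>z. z \<in> Z \<Longrightarrow> dist x0 z + R \<le> R0"
    and bad: "\<And>z. z \<in> Z \<Longrightarrow> \<not> averages_le X \<mu> u z R t"
  shows "\<exists>W\<in>fmeasurable \<mu>. Z \<subseteq> W \<and> t * measure \<mu> W \<le> D\<^sup>2 * (LINT z:X \<inter> ball x0 R0|\<mu>. u z)"
proof -
  define B0 where "B0 = X \<inter> ball x0 R0"
  define b where "b = (LINT z:B0|\<mu>. u z)"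
  have b: "0 \<le> b"
    unfolding b_def set_lebesgue_integral_def using u(1) by (intro Bochner_Integration.integral_nonneg) simp
  have "\<exists>\<rho>. 0 < \<rho> \<and> \<rho> \<le> R \<and> t * measure \<mu> (X \<inter> ball z \<rho>) < (LINT w:X \<inter> ball z \<rho>|\<mu>. u w)"
    if "z \<in> Z" for z
    using bad[OF that] unfolding averages_le_def by (auto simp: not_le)
  then obtain \<rho> where \<rho>: "\<And>z. z \<in> Z \<Longrightarrow> 0 < \<rho> z" "\<And>z. z \<in> Z \<Longrightarrow> \<rho> z \<le> R"
      "\<And>z. z \<in> Z \<Longrightarrow> t * measure \<mu> (X \<inter> ball z (\<rho> z)) < (LINT w:X \<inter> ball z (\<rho> z)|\<mu>. u w)"
    by metis
  define W where "W = (\<Union>z\<in>Z. X \<inter> ball z (\<rho> z))"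
  have "W = X \<inter> (\<Union>z\<in>Z. ball z (\<rho> z))" by (auto simp: W_def)
  moreover have "openin (top_of_set X) (X \<inter> (\<Union>z\<in>Z. ball z (\<rho> z)))"
    by (intro openin_open_Int open_UN) simp
  ultimately have W: "W \<in> sets \<mu>" by (simp add: openin_in_sets)
  have sub: "X \<inter> ball z (\<rho> z) \<subseteq> B0" if "z \<in> Z" for z
  proof
    fix w assume "w \<in> X \<inter> ball z (\<rho> z)"
    then show "w \<in> B0"
      using dist_triangle[of x0 w z] Z(2)[OF that] \<rho>(2)[OF that] by (auto simp: B0_def)
  qed
  have "emeasure \<mu> K \<le> ennreal (D\<^sup>2 * b / t)" if K: "compact K" "K \<subseteq> W" for K
  proof -
    obtain I where I: "I \<subseteq> Z" "finite I" "K \<subseteq> (\<Union>z\<in>I. ball z (\<rho> z))"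
      using compactE_image[OF K(1), of Z "\<lambda>z. ball z (\<rho> z)"] K(2) by (auto simp: W_def)
    obtain J where J: "J \<subseteq> I" "disjoint_family_on (\<lambda>z. ball z (\<rho> z)) J"
        "(\<Union>z\<in>I. ball z (\<rho> z)) \<subseteq> (\<Union>z\<in>J. ball z (3 * \<rho> z))"
      using finite_Vitali_covering[OF I(2), of \<rho>] by blast
    have JZ: "z \<in> Z" "z \<in> X" if "z \<in> J" for z using that J(1) I(1) Z(1) by auto
    have "finite J" using J(1) I(2) by (rule finite_subset)
    have sets: "X \<inter> ball z r \<in> sets \<mu>" if "z \<in> J" for z r
      using ball_fmeasurable JZ(2)[OF that] by (blast dest: fmeasurableD)
    have int: "set_integrable \<mu> (X \<inter> ball z (\<rho> z)) u" if "z \<in> J" for z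
      by (rule set_integrable_subset[OF u(2)]) (use sub JZ[OF that] sets[OF that] in \<open>auto simp: B0_def\<close>)
    have "K \<subseteq> (\<Union>z\<in>J. X \<inter> ball z (3 * \<rho> z))"
      using I(3) J(3) K(2) by (auto simp: W_def)
    then have "emeasure \<mu> K \<le> emeasure \<mu> (\<Union>z\<in>J. X \<inter> ball z (3 * \<rho> z))"
      using sets \<open>finite J\<close> by (intro emeasure_mono sets.finite_UN) auto
    also have "\<dots> \<le> (\<Sum>z\<in>J. emeasure \<mu> (X \<inter> ball z (3 * \<rho> z)))"
      using sets \<open>finite J\<close> by (intro emeasure_subadditive_finite) auto
    also have "\<dots> = (\<Sum>z\<in>J. ennreal (measure \<mu> (X \<inter> ball z (3 * \<rho> z))))"
      using JZ by (intro sum.cong refl emeasure_eq_measure2 ball_fmeasurable)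
    also have "\<dots> = ennreal (\<Sum>z\<in>J. measure \<mu> (X \<inter> ball z (3 * \<rho> z)))"
      by (rule sum_ennreal) simp
    also have "\<dots> \<le> ennreal (D\<^sup>2 * b / t)"
    proof (rule ennreal_leI)
      have "t * measure \<mu> (X \<inter> ball z (3 * \<rho> z)) \<le> D\<^sup>2 * (LINT w:X \<inter> ball z (\<rho> z)|\<mu>. u w)"
        if "z \<in> J" for z
      proof -
        have "measure \<mu> (X \<inter> ball z (3 * \<rho> z)) \<le> D\<^sup>2 * measure \<mu> (X \<inter> ball z (\<rho> z))"
        proof (rule doubling_le)
          have "2\<^sup>2 * \<rho> z \<le> 4 * R" using \<rho>(2) JZ[OF that] by simp
          then show "ereal (2\<^sup>2 * \<rho> z) < r0" using R by (meson ereal_less_eq(3) le_less_trans)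
        qed (use \<rho>(1) JZ[OF that] in auto)
        then have "t * measure \<mu> (X \<inter> ball z (3 * \<rho> z)) \<le> D\<^sup>2 * (t * measure \<mu> (X \<inter> ball z (\<rho> z)))"
          using t by simp
        also have "\<dots> \<le> D\<^sup>2 * (LINT w:X \<inter> ball z (\<rho> z)|\<mu>. u w)"
          using \<rho>(3) JZ[OF that] by (intro mult_left_mono) (auto intro: less_imp_le)
        finally show ?thesis .
      qed
      then have upper: "t * (\<Sum>z\<in>J. measure \<mu> (X \<inter> ball z (3 * \<rho> z)))
          \<le> D\<^sup>2 * (\<Sum>z\<in>J. LINT w:X \<inter> ball z (\<rho> z)|\<mu>. u w)"
        unfolding sum_distrib_left by (rule sum_mono)
      have "(\<Sum>z\<in>J. LINT w:X \<inter> ball z (\<rho> z)|\<mu>. u w) = (LINT w:(\<Union>z\<in>J. X \<inter> ball z (\<rho> z))|\<mu>. u w)"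
        using \<open>finite J\<close> J(2) int sets
        by (intro set_integral_finite_Union[symmetric]) (auto simp: disjoint_family_on_def)
      also have "\<dots> \<le> b"
        unfolding b_def
      proof (rule set_integral_mono_domain[OF u(1)])
        show "set_integrable \<mu> B0 u" using u(2) by (simp add: B0_def)
        show "(\<Union>z\<in>J. X \<inter> ball z (\<rho> z)) \<in> sets \<mu>" using sets \<open>finite J\<close> by (intro sets.finite_UN)
        show "(\<Union>z\<in>J. X \<inter> ball z (\<rho> z)) \<subseteq> B0" using sub JZ(1) by blast
      qed
      finally have "D\<^sup>2 * (\<Sum>z\<in>J. LINT w:X \<inter> ball z (\<rho> z)|\<mu>. u w) \<le> D\<^sup>2 * b"
        by (rule mult_left_mono) simp
      with upper have "t * (\<Sum>z\<in>J. measure \<mu> (X \<inter> ball z (3 * \<rho> z))) \<le> D\<^sup>2 * b" by linarith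
      then show "(\<Sum>z\<in>J. measure \<mu> (X \<inter> ball z (3 * \<rho> z))) \<le> D\<^sup>2 * b / t"
        using t by (simp add: pos_le_divide_eq mult.commute)
    qed
    finally show ?thesis .
  qed
  then have "emeasure \<mu> W \<le> ennreal (D\<^sup>2 * b / t)"
    unfolding inner_regular[OF W] by (intro SUP_least) auto
  then have "measure \<mu> W \<le> D\<^sup>2 * b / t"
    unfolding measure_def using b t by (intro enn2real_leI) auto
  then have "t * measure \<mu> W \<le> D\<^sup>2 * b" using t by (simp add: field_simps)
  moreover have "Z \<subseteq> W" using Z(1) \<rho>(1) by (force simp: W_def)
  moreover have "W \<in> fmeasurable \<mu>"
  proof (rule fmeasurableI2[OF _ _ W])
    show "B0 \<in> fmeasurable \<mu>" unfolding B0_def using x0 by (rule ball_fmeasurable)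
    show "W \<subseteq> B0" using sub by (auto simp: W_def)
  qed
  ultimately show ?thesis unfolding b_def B0_def by blast
qed

section \<open>Increments along a fragment\<close>

text \<open>A substitute for the fundamental theorem of calculus, in terms of difference quotients. The hypothesis
\<open>slope\<close> asks for good steps \<open>h\<close> at arbitrarily small scales only, as the lower limit in the definition of
\<^const>\<open>lower_lip\<close> provides. Up to an error \<open>\<eta>\<close>, the bound is propagated by continuous induction:
the last time \<open>s\<close> up to which it holds lies in \<open>K\<close>, and if \<open>s < T\<close>, a good step \<open>h\<close> from \<open>s\<close>,
followed by a jump across the gap around \<open>s + h\<close> if there is one, leads to a later such time. The point
\<open>0\<close> is exempt from \<open>slope\<close>; continuity and \<open>\<eta>\<close> take care of it.\<close>
lemma increment_bound_on_compact:
  fixes \<phi> :: "real \<Rightarrow> real"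
  assumes K: "compact K" "K \<subseteq> {0..T}" "0 \<in> K" "T \<in> K" and T: "0 < T"
    and cont: "continuous_on K \<phi>" and \<Lambda>: "0 \<le> \<Lambda>" and A: "0 \<le> A"
    and slope: "\<And>t \<epsilon>. t \<in> K \<Longrightarrow> 0 < t \<Longrightarrow> t < T \<Longrightarrow> 0 < \<epsilon> \<Longrightarrow>
      \<exists>h. 0 < h \<and> h < \<epsilon> \<and> (\<forall>s\<in>K. t \<le> s \<and> s < t + h \<longrightarrow> \<bar>\<phi> s - \<phi> t\<bar> \<le> \<Lambda> * h)"
    and jump: "\<And>s t. s \<in> K \<Longrightarrow> t \<in> K \<Longrightarrow> s < t \<Longrightarrow> {s<..<t} \<inter> K = {} \<Longrightarrow> \<bar>\<phi> t - \<phi> s\<bar> \<le> A * (t - s)"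
  shows "\<bar>\<phi> T - \<phi> 0\<bar> \<le> \<Lambda> * T + A * (T - measure lebesgue K)"
proof (rule field_le_epsilon)
  fix \<eta> :: real assume \<eta>: "0 < \<eta>"
  define m where "m t = measure lebesgue ({0..t} - K)" for t
  have Kf: "K \<in> lmeasurable" using K(1) by (rule lmeasurable_compact)
  have mf: "{0..t} - K \<in> lmeasurable" for t
    using Kf by (intro fmeasurable_Diff) (auto simp: fmeasurableD)
  have m_mono: "m s \<le> m t" if "s \<le> t" for s t
    unfolding m_def using mf that by (intro measure_mono_fmeasurable) (auto dest: fmeasurableD)
  have m_nonneg: "0 \<le> m t" for t by (simp add: m_def)
  have m_T: "m T = T - measure lebesgue K"
    unfolding m_def using K T Kf by (subst measurable_measure_Diff) (auto simp: fmeasurableD)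
  have m_gap: "m s + (t - s') \<le> m t" if "s \<le> s'" "s' < t" "0 \<le> s'" "{s'<..<t} \<inter> K = {}" for s s' t
  proof -
    have "m s + (t - s') = measure lebesgue ({0..s} - K) + measure lebesgue {s'<..<t}
        - measure lebesgue (({0..s} - K) \<inter> {s'<..<t})"
    proof -
      have "({0..s} - K) \<inter> {s'<..<t} = {}" using that(1) by auto
      then show ?thesis using that(2) by (simp add: m_def)
    qed
    also have "\<dots> = measure lebesgue (({0..s} - K) \<union> {s'<..<t})"
      using mf by (intro measure_Un3[symmetric]) auto
    also have "\<dots> \<le> m t"
      unfolding m_def
    proof (rule measure_mono_fmeasurable)
      show "({0..s} - K) \<union> {s'<..<t} \<subseteq> {0..t} - K" using that by auto
      show "({0..s} - K) \<union> {s'<..<t} \<in> sets lebesgue" using mf[of s] by (auto dest: fmeasurableD)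
    qed (rule mf)
    finally show ?thesis .
  qed
  define P where "P t \<longleftrightarrow> \<bar>\<phi> t - \<phi> 0\<bar> \<le> \<eta> + \<Lambda> * t + A * m t" for t
  \<comment> \<open>The first point of \<open>K\<close> at or after the time \<open>e\<close>.\<close>
  have next_point: "\<exists>t\<in>K. e \<le> t \<and> {s. e \<le> s \<and> s < t} \<inter> K = {}" if "e \<le> T" for e
  proof -
    define N where "N = K \<inter> {e..}"
    have N: "closed N" "N \<noteq> {}" "bdd_below N"
      using K that compact_imp_closed[OF K(1)] by (auto simp: N_def)
    have "Inf N \<in> N" using closed_contains_Inf[OF N(2,3,1)] .
    moreover have "s \<notin> K" if "e \<le> s" "s < Inf N" for s
      using cInf_lower[OF _ N(3), of s] that by (auto simp: N_def)
    ultimately show ?thesis by (intro bexI[of _ "Inf N"]) (auto simp: N_def)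
  qed
  \<comment> \<open>The induction starts at a positive time: at the right end of a gap that begins at \<open>0\<close>, or, if \<open>0\<close> is an
accumulation point of \<open>K\<close>, at a time so small that the increment is below \<open>\<eta>\<close>.\<close>
  have "\<exists>t\<in>K. 0 < t \<and> P t"
  proof (cases "\<exists>e>0. {0<..<e} \<inter> K = {}")
    case True
    then obtain e where e: "e > 0" "{0<..<e} \<inter> K = {}" by blast
    then have "e \<le> T" using K(4) T by (meson disjoint_iff greaterThanLessThan_iff not_le)
    then obtain t where t: "t \<in> K" "e \<le> t" "{s. e \<le> s \<and> s < t} \<inter> K = {}"
      using next_point by blast
    have "{0<..<t} \<inter> K \<subseteq> {0<..<e} \<inter> K \<union> {s. e \<le> s \<and> s < t} \<inter> K" by auto
    then have "{0<..<t} \<inter> K = {}" using e(2) t(3) by blast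
    then have "\<bar>\<phi> t - \<phi> 0\<bar> \<le> A * t" "t \<le> m t"
      using jump[OF K(3) t(1)] m_gap[of 0 0 t] m_nonneg[of 0] t(2) e(1) by auto
    moreover have "A * t \<le> A * m t" using A \<open>t \<le> m t\<close> by (rule mult_left_mono[rotated])
    moreover have "0 \<le> \<Lambda> * t" using \<Lambda> t(2) e(1) by simp
    ultimately have "P t" unfolding P_def using \<eta> by linarith
    then show ?thesis using t(1,2) e(1) by (intro bexI[of _ t]) auto
  next
    case False
    obtain e where e: "e > 0" "\<And>s. s \<in> K \<Longrightarrow> dist s 0 < e \<Longrightarrow> dist (\<phi> s) (\<phi> 0) < \<eta>"
      using cont K(3) \<eta> unfolding continuous_on_iff by blast
    obtain t where t: "t \<in> K" "0 < t" "t < e" using False e(1) by force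
    then have "\<bar>\<phi> t - \<phi> 0\<bar> < \<eta>" using e(2)[of t] by (simp add: dist_real_def)
    moreover have "0 \<le> \<Lambda> * t" "0 \<le> A * m t" using \<Lambda> A m_nonneg t by auto
    ultimately have "P t" unfolding P_def by linarith
    then show ?thesis using t by blast
  qed
  then obtain t0 where t0: "t0 \<in> K" "0 < t0" "P t0" by blast
  define S where "S = {t\<in>K. t0 \<le> t \<and> P t}"
  define s where "s = Sup S"
  have S: "S \<noteq> {}" "bdd_above S" "S \<subseteq> K"
    using t0 K(2) by (auto simp: S_def intro!: bdd_aboveI[of _ T])
  have s_cl: "s \<in> closure S" unfolding s_def using S by (intro closure_contains_Sup)
  have "closure S \<subseteq> K" using S(3) compact_imp_closed[OF K(1)] by (rule closure_minimal)
  then have sK: "s \<in> K" using s_cl by blast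
  have "t0 \<le> s" unfolding s_def using t0 S(2) by (intro cSup_upper) (auto simp: S_def)
  have "P s"
    unfolding P_def
  proof (rule field_le_epsilon)
    fix e :: real assume "0 < e"
    then obtain d where d: "d > 0" "\<And>t. t \<in> K \<Longrightarrow> dist t s < d \<Longrightarrow> dist (\<phi> t) (\<phi> s) < e"
      using cont sK unfolding continuous_on_iff by blast
    obtain t where t: "t \<in> S" "dist t s < d" using s_cl d(1) closure_approachable by blast
    have "t \<le> s" unfolding s_def using t(1) S(2) by (rule cSup_upper)
    have "\<bar>\<phi> t - \<phi> s\<bar> < e" using d(2)[of t] t S(3) by (auto simp: dist_real_def)
    moreover have "\<bar>\<phi> t - \<phi> 0\<bar> \<le> \<eta> + \<Lambda> * t + A * m t" using t(1) by (auto simp: S_def P_def)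
    moreover have "\<Lambda> * t \<le> \<Lambda> * s" "A * m t \<le> A * m s"
      using \<Lambda> A m_mono \<open>t \<le> s\<close> by (auto intro: mult_left_mono)
    ultimately show "\<bar>\<phi> s - \<phi> 0\<bar> \<le> \<eta> + \<Lambda> * s + A * m s + e" by linarith
  qed
  have "s = T"
  proof (rule ccontr)
    assume "s \<noteq> T"
    then have sT: "s < T" using sK K(2) by force
    obtain h where h: "0 < h" "h < T - s" "\<And>t. t \<in> K \<Longrightarrow> s \<le> t \<Longrightarrow> t < s + h \<Longrightarrow> \<bar>\<phi> t - \<phi> s\<bar> \<le> \<Lambda> * h"
      using slope[OF sK _ sT, of "T - s"] sT \<open>t0 \<le> s\<close> t0(2) by auto
    define N where "N = K \<inter> {s..<s + h}"
    have N: "N \<noteq> {}" "bdd_above N" using sK h(1) by (auto simp: N_def intro!: bdd_aboveI[of _ "s + h"])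
    define s' where "s' = Sup N"
    have s'_cl: "s' \<in> closure N" unfolding s'_def using N by (intro closure_contains_Sup)
    have "closed {t\<in>K. \<bar>\<phi> t - \<phi> s\<bar> \<le> \<Lambda> * h}"
      using compact_imp_closed[OF K(1)] cont
      by (intro continuous_on_closed_Collect_le continuous_intros) 
    then have "closure N \<subseteq> {t\<in>K. \<bar>\<phi> t - \<phi> s\<bar> \<le> \<Lambda> * h}"
      using h(3) by (intro closure_minimal) (auto simp: N_def)
    then have s'K: "s' \<in> K" "\<bar>\<phi> s' - \<phi> s\<bar> \<le> \<Lambda> * h" using s'_cl by auto
    have s': "s \<le> s'" "s' \<le> s + h"
      unfolding s'_def using N sK h(1)
      by (auto intro!: cSup_upper cSup_least simp: N_def)
    obtain t where t: "t \<in> K" "s + h \<le> t" "{u. s + h \<le> u \<and> u < t} \<inter> K = {}"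
      using next_point[of "s + h"] h(2) by auto
    \<comment> \<open>From the last point \<open>s'\<close> of \<open>K\<close> before \<open>s + h\<close>, or its limit, either \<open>t = s'\<close> or a gap leads to \<open>t\<close>.\<close>
    have last: "\<bar>\<phi> t - \<phi> s'\<bar> + A * m s \<le> A * m t"
    proof (cases "s' = t")
      case True
      then show ?thesis using m_mono[of s t] A s'(1) by (simp add: mult_left_mono)
    next
      case False
      then have "s' < t" using s'(2) t(2) by simp
      have empty: "{s'<..<t} \<inter> K = {}"
      proof -
        have "u \<le> s' \<or> s + h \<le> u" if "u \<in> K" "s' < u" for u
        proof (rule ccontr)
          assume "\<not> ?thesis"
          then have "u \<in> N" using that s'(1) by (auto simp: N_def)
          then show False using cSup_upper[OF _ N(2), of u] that(2) by (simp add: s'_def)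
        qed
        then show ?thesis using t(3) by force
      qed
      have "0 \<le> s'" using s'(1) \<open>t0 \<le> s\<close> t0(2) by simp
      have "A * (m s + (t - s')) \<le> A * m t"
        using m_gap[OF s'(1) \<open>s' < t\<close> \<open>0 \<le> s'\<close> empty] A by (rule mult_left_mono)
      then show ?thesis using jump[OF s'K(1) t(1) \<open>s' < t\<close> empty] by (simp add: algebra_simps)
    qed
    have "\<Lambda> * (s + h) \<le> \<Lambda> * t" using t(2) \<Lambda> by (rule mult_left_mono)
    then have "\<Lambda> * h + \<Lambda> * s \<le> \<Lambda> * t" by (simp add: algebra_simps)
    then have "P t" using \<open>P s\<close> last s'K(2) unfolding P_def by linarith
    then have "t \<in> S" using t \<open>t0 \<le> s\<close> h(1) by (auto simp: S_def)
    then have "t \<le> s" unfolding s_def using S(2) by (rule cSup_upper)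
    then show False using t(2) h(1) by simp
  qed
  then show "\<bar>\<phi> T - \<phi> 0\<bar> \<le> \<Lambda> * T + A * (T - measure lebesgue K) + \<eta>"
    using \<open>P s\<close> m_T unfolding P_def by simp
qed

section \<open>The lower pointwise Lipschitz constant\<close>
context
  fixes X :: "'a::metric_space set" and f :: "'a \<Rightarrow> real" and L :: real
  assumes f: "L-lipschitz_on X f"
begin

definition "steepness r x = (SUP y\<in>X \<inter> ball x r. ennreal (\<bar>f x - f y\<bar> / r))"

lemma steepness_le:
  assumes "x \<in> X" "0 < r" shows "steepness r x \<le> ennreal L"
  unfolding steepness_def
proof (intro SUP_least ennreal_leI)
  fix y assume y: "y \<in> X \<inter> ball x r"
  have "\<bar>f x - f y\<bar> \<le> L * dist x y"
    using lipschitz_onD[OF f, of x y] assms y by (auto simp: dist_real_def)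
  also have "\<dots> \<le> L * r" using y lipschitz_on_nonneg[OF f] by (intro mult_left_mono) auto
  finally show "\<bar>f x - f y\<bar> / r \<le> L" using assms(2) by (simp add: field_simps)
qed

lemma Liminf_steepness_le:
  assumes "x \<in> X" shows "Liminf (at_right 0) (\<lambda>r. steepness r x) \<le> ennreal L"
proof -
  have "eventually (\<lambda>r. steepness r x \<le> ennreal L) (at_right 0)"
    using assms steepness_le by (auto simp: eventually_at_right_field intro!: exI[of _ 1])
  then have "Limsup (at_right 0) (\<lambda>r. steepness r x) \<le> ennreal L" by (rule Limsup_bounded)
  with Liminf_le_Limsup[of "at_right (0::real)" "\<lambda>r. steepness r x"] show ?thesis
    by (meson order_trans trivial_limit_at_right_real)
qed

lemma lower_lip_eq: "lower_lip X f x = enn2real (Liminf (at_right 0) (\<lambda>r. steepness r x))"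
  unfolding lower_lip_def steepness_def ..

lemma lower_lip_le: "x \<in> X \<Longrightarrow> lower_lip X f x \<le> L"
  unfolding lower_lip_eq using Liminf_steepness_le lipschitz_on_nonneg[OF f] by (intro enn2real_leI)

lemma small_slope_if_lower_lip_less:
  assumes x: "x \<in> X" and less: "lower_lip X f x < \<Lambda>" and \<epsilon>: "0 < \<epsilon>"
  shows "\<exists>h. 0 < h \<and> h < \<epsilon> \<and> (\<forall>y\<in>X \<inter> ball x h. \<bar>f x - f y\<bar> \<le> \<Lambda> * h)"
proof (rule ccontr)
  assume neg: "\<not> ?thesis"
  have "ennreal \<Lambda> \<le> steepness h x" if "0 < h" "h < \<epsilon>" for h
  proof -
    have "\<not> (\<forall>y\<in>X \<inter> ball x h. \<bar>f x - f y\<bar> \<le> \<Lambda> * h)" using neg that by blast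
    then obtain y where y: "y \<in> X \<inter> ball x h" "\<Lambda> * h < \<bar>f x - f y\<bar>"
      by (auto simp: not_le)
    then have "\<Lambda> \<le> \<bar>f x - f y\<bar> / h" using that(1) by (simp add: field_simps)
    then have "ennreal \<Lambda> \<le> ennreal (\<bar>f x - f y\<bar> / h)" by (rule ennreal_leI)
    also have "\<dots> \<le> steepness h x" unfolding steepness_def using y(1) by (rule SUP_upper)
    finally show ?thesis .
  qed
  then have "eventually (\<lambda>h. ennreal \<Lambda> \<le> steepness h x) (at_right 0)"
    using \<epsilon> by (auto simp: eventually_at_right_field)
  then have "ennreal \<Lambda> \<le> Liminf (at_right 0) (\<lambda>r. steepness r x)" by (rule Liminf_bounded)
  then have "enn2real (ennreal \<Lambda>) \<le> lower_lip X f x"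
    unfolding lower_lip_eq using Liminf_steepness_le[OF x]
    by (intro enn2real_mono) (auto simp: le_less_trans)
  moreover have "0 \<le> lower_lip X f x" by (simp add: lower_lip_eq)
  ultimately show False using less by simp
qed

text \<open>For open balls the sets where the supremum exceeds a given value are relatively open.\<close>
lemma steepness_measurable:
  assumes "0 < r" shows "steepness r \<in> borel_measurable (restrict_space borel X)"
proof (rule borel_measurableI_greater)
  fix a :: ennreal
  have cont: "continuous_on X f" using f by (rule lipschitz_on_continuous_on)
  define V where "V y = X \<inter> ball y r \<inter> (X \<inter> (\<lambda>x. ennreal (\<bar>f x - f y\<bar> / r)) -` {a<..})" for y
  have V: "openin (top_of_set X) (V y)" for y
    unfolding V_def using cont assms
    by (intro openin_Int openin_open_Int continuous_openin_preimage_gen continuous_on_ennreal continuous_intros) auto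
  have "{x \<in> space (restrict_space borel X). a < steepness r x} = \<Union>(V ` X)"
    by (auto simp: V_def steepness_def space_restrict_space less_SUP_iff dist_commute)
  moreover have "openin (top_of_set X) (\<Union>(V ` X))" using V by (intro openin_Union) auto
  then obtain W where "open W" "\<Union>(V ` X) = X \<inter> W" unfolding openin_open by blast
  ultimately show "{x \<in> space (restrict_space borel X). a < steepness r x} \<in> sets (restrict_space borel X)"
    by (simp add: sets_restrict_space)
qed

text \<open>Rational radii suffice: if \<open>q\<close> increases to \<open>r\<close>, then \<open>steepness q x \<le> (r / q) steepness r x\<close>, with
a factor that tends to \<open>1\<close>. This presents the lower limit as a countable expression, hence as a measurable function.\<close>
lemma Liminf_steepness_eq:
  assumes x: "x \<in> X"
  shows "Liminf (at_right 0) (\<lambda>r. steepness r x)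
    = (SUP n. INF r\<in>\<rat> \<inter> {0<..<1 / real (Suc n)}. steepness r x)"
proof (rule antisym)
  show "Liminf (at_right 0) (\<lambda>r. steepness r x)
    \<le> (SUP n. INF r\<in>\<rat> \<inter> {0<..<1 / real (Suc n)}. steepness r x)"
    unfolding Liminf_def
  proof (rule SUP_least)
    fix P :: "real \<Rightarrow> bool" assume "P \<in> {P. eventually P (at_right 0)}"
    then obtain b where b: "b > 0" "\<And>r. 0 < r \<Longrightarrow> r < b \<Longrightarrow> P r"
      by (auto simp: eventually_at_right_field)
    obtain n where "1 / real (Suc n) < b" using b(1) nat_approx_posE by blast
    then have "(INF r\<in>Collect P. steepness r x) \<le> (INF r\<in>\<rat> \<inter> {0<..<1 / real (Suc n)}. steepness r x)"
      using b(2) by (intro INF_superset_mono) auto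
    also have "\<dots> \<le> (SUP n. INF r\<in>\<rat> \<inter> {0<..<1 / real (Suc n)}. steepness r x)"
      by (rule SUP_upper) simp
    finally show "(INF r\<in>Collect P. steepness r x)
      \<le> (SUP n. INF r\<in>\<rat> \<inter> {0<..<1 / real (Suc n)}. steepness r x)" .
  qed
  have "(INF q\<in>\<rat> \<inter> {0<..<1 / real (Suc n)}. steepness q x) \<le> steepness r x"
    if r: "0 < r" "r < 1 / real (Suc n)" for n r
  proof (rule ennreal_le_epsilon)
    fix e :: real assume e: "0 < e"
    define a where "a = enn2real (steepness r x)"
    have "steepness r x < top" using steepness_le[OF x r(1)] by (simp add: le_less_trans)
    then have a: "steepness r x = ennreal a" "0 \<le> a" by (auto simp: a_def)
    have "a * r / (a + e) < r" using a(2) e r(1) by (simp add: field_simps)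
    moreover have "0 \<le> a * r / (a + e)" using a(2) e r(1) by simp
    ultimately obtain q where q: "q \<in> \<rat>" "a * r / (a + e) < q" "q < r"
      using Rats_dense_in_real by blast
    have q0: "0 < q" using q(2) \<open>0 \<le> a * r / (a + e)\<close> by linarith
    have "steepness q x \<le> ennreal (a + e)"
      unfolding steepness_def[of q]
    proof (intro SUP_least ennreal_leI)
      fix y assume y: "y \<in> X \<inter> ball x q"
      have "ennreal (\<bar>f x - f y\<bar> / r) \<le> ennreal a"
        unfolding a(1)[symmetric] steepness_def using y q(3) by (intro SUP_upper) auto
      then have "\<bar>f x - f y\<bar> \<le> a * r" using a(2) r(1) by (simp add: field_simps)
      also have "\<dots> \<le> (a + e) * q" using q(2) a(2) e by (simp add: field_simps)
      finally show "\<bar>f x - f y\<bar> / q \<le> a + e" using q0 by (simp add: field_simps)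
    qed
    moreover have "(INF q\<in>\<rat> \<inter> {0<..<1 / real (Suc n)}. steepness q x) \<le> steepness q x"
      using q q0 r(2) by (intro INF_lower) auto
    ultimately show "(INF q\<in>\<rat> \<inter> {0<..<1 / real (Suc n)}. steepness q x) \<le> steepness r x + ennreal e"
      using a(2) e unfolding a(1) by (simp add: ennreal_plus[symmetric] del: ennreal_plus)
  qed
  then have "eventually (\<lambda>r. (INF q\<in>\<rat> \<inter> {0<..<1 / real (Suc n)}. steepness q x) \<le> steepness r x) (at_right 0)" for n
    unfolding eventually_at_right_field by (intro exI[of _ "1 / real (Suc n)"]) auto
  then show "(SUP n. INF r\<in>\<rat> \<inter> {0<..<1 / real (Suc n)}. steepness r x)
    \<le> Liminf (at_right 0) (\<lambda>r. steepness r x)"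
    by (intro SUP_least Liminf_bounded)
qed

lemma lower_lip_measurable: "lower_lip X f \<in> borel_measurable (restrict_space borel X)"
proof -
  have "(\<lambda>x. SUP n. INF r\<in>\<rat> \<inter> {0<..<1 / real (Suc n)}. steepness r x)
      \<in> borel_measurable (restrict_space borel X)"
    using countable_rat steepness_measurable
    by (intro borel_measurable_SUP borel_measurable_INF) auto
  then have "(\<lambda>x. enn2real (SUP n. INF r\<in>\<rat> \<inter> {0<..<1 / real (Suc n)}. steepness r x))
      \<in> borel_measurable (restrict_space borel X)"
    by measurable
  then show ?thesis
    by (rule measurable_cong[THEN iffD1, rotated])
       (simp add: space_restrict_space lower_lip_eq Liminf_steepness_eq)
qed

end

section \<open>A Morrey inequality for the lower Lipschitz constant\<close>
lemma gap_length_le: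
  assumes "compact K" "K \<subseteq> {0..T}" "s \<in> K" "t \<in> K" "s < t" "{s<..<t} \<inter> K = {}"
  shows "t - s \<le> T - measure lebesgue K"
proof -
  have sub: "{s<..<t} \<subseteq> {0..T}" "0 \<le> T" using assms(2-5) by force+
  have "measure lebesgue K \<le> measure lebesgue ({0..T} - {s<..<t})"
    using assms by (intro measure_mono_fmeasurable) (auto simp: lmeasurable_compact fmeasurableD)
  also have "\<dots> = measure lebesgue {0..T} - measure lebesgue {s<..<t}"
    using sub by (intro measurable_measure_Diff) auto
  finally show ?thesis using sub(2) assms(5) by simp
qed

context doubling_space
begin

lemma lower_lip_powr_integrable:
  assumes "L-lipschitz_on X f" "0 \<le> q" "x \<in> X"
  shows "set_integrable \<mu> (X \<inter> ball x r) (\<lambda>z. lower_lip X f z powr q)"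
proof (rule set_integrable_bounded[OF ball_fmeasurable[OF assms(3)]])
  have "lower_lip X f \<in> borel_measurable \<mu>"
    using lower_lip_measurable[OF assms(1)] by (simp cong: measurable_cong_sets add: sets_eq)
  then show "(\<lambda>z. lower_lip X f z powr q) \<in> borel_measurable \<mu>" by measurable
  show "\<bar>lower_lip X f z powr q\<bar> \<le> L powr q" if "z \<in> X \<inter> ball x r" for z
    using lower_lip_le[OF assms(1), of z] that assms(2)
    by (auto simp: lower_lip_def intro!: powr_mono2)
qed

context
  fixes Cb \<epsilon> N q L :: real and f :: "'a \<Rightarrow> real"
  assumes Cb: "1 \<le> Cb" and q: "1 \<le> q" "D + D ^ 3 < \<epsilon> * 2 powr q" and N: "2 * Cb \<le> N"
    and joined: "\<And>E x y. x \<in> X \<Longrightarrow> y \<in> X \<Longrightarrow> 0 < dist x y \<Longrightarrow> ereal (N * dist x y) < r0 \<Longrightarrow> E \<in> sets \<mu> \<Longrightarrow>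
      measure \<mu> (E \<inter> ball x (Cb * dist x y)) < \<epsilon> * measure \<mu> (X \<inter> ball x (Cb * dist x y)) \<Longrightarrow>
      joined_by_fragment X E Cb (1 / 4) x y"
    and f: "L-lipschitz_on X f"
begin

abbreviation (input) "slope_power \<equiv> \<lambda>z. lower_lip X f z powr q"

lemma slope_power_nonneg: "0 \<le> slope_power z"
  by simp

lemma slope_power_integrable: "x \<in> X \<Longrightarrow> set_integrable \<mu> (X \<inter> ball x r) slope_power"
  using lower_lip_powr_integrable[OF f] q by simp

text \<open>The Morrey inequality up to an additive error \<open>A\<close> in the constant. The averages are controlled at \<open>x\<close> only,
and up to a radius proportional to \<open>d(x,y)\<close>; so the condition becomes weaker for the
short pairs formed by the ends of a gap.\<close>
definition "Morrey_with_error A \<longleftrightarrow>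
  (\<forall>\<nu> x y. 0 < \<nu> \<and> x \<in> X \<and> y \<in> X \<and> 0 < dist x y \<and> ereal (N * dist x y) < r0 \<and>
     averages_le X \<mu> slope_power x (2 * Cb * dist x y) (\<nu> powr q) \<longrightarrow>
     \<bar>f x - f y\<bar> \<le> (4 * Cb * \<nu> + A) * dist x y)"

text \<open>The exceptional set consists of the points with \<open>lip f \<ge> 2 \<nu>\<close>, controlled by Chebyshev's inequality, and of those
where the maximal function exceeds \<open>(2 \<nu>)\<^sup>q\<close>, controlled by the weak type inequality. Each has a measure of the order
\<open>2\<^sup>-\<^sup>q \<mu>(B)\<close>, independently of \<open>\<nu>\<close>; the choice of \<open>q\<close> makes it smaller than \<open>\<epsilon> \<mu>(B)\<close>. The
maximal function is restricted to radii up to \<open>Cb d/2\<close>: this keeps its balls inside \<open>B(x, 2 Cb d)\<close>, and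
it suffices for gaps shorter than \<open>d/4\<close>.\<close>
lemma bad_set_density:
  assumes \<nu>: "0 < \<nu>" and x: "x \<in> X" and d: "0 < d" "ereal (N * d) < r0"
    and avg: "averages_le X \<mu> slope_power x (2 * Cb * d) (\<nu> powr q)"
  shows "\<exists>E\<in>sets \<mu>. measure \<mu> (E \<inter> ball x (Cb * d)) < \<epsilon> * measure \<mu> (X \<inter> ball x (Cb * d)) \<and>
    (\<forall>z\<in>X - E. lower_lip X f z < 2 * \<nu> \<and>
       (dist x z < Cb * d \<longrightarrow> averages_le X \<mu> slope_power z (Cb * d / 2) ((2 * \<nu>) powr q)))"
proof -
  define B where "B = X \<inter> ball x (Cb * d)"
  have B: "B \<in> fmeasurable \<mu>" "0 < measure \<mu> B"
    unfolding B_def using ball_fmeasurable ball_pos x d(1) Cb by auto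
  have scale: "ereal (2 * Cb * d) < r0"
  proof -
    have "2 * Cb * d \<le> N * d" using N d(1) by simp
    then show ?thesis using d(2) by (meson ereal_less_eq(3) le_less_trans)
  qed
  have pow: "(2 * \<nu>) powr q = 2 powr q * \<nu> powr q" using \<nu> by (simp add: powr_mult)
  have \<nu>q: "0 < \<nu> powr q" using \<nu> by simp
  define I where "I = (LINT z:X \<inter> ball x (2 * Cb * d)|\<mu>. slope_power z)"
  have I: "I \<le> \<nu> powr q * (D * measure \<mu> B)"
  proof -
    have "I \<le> \<nu> powr q * measure \<mu> (X \<inter> ball x (2 * Cb * d))"
      using avg d(1) Cb unfolding averages_le_def I_def by simp
    also have "\<dots> \<le> \<nu> powr q * (D * measure \<mu> B)"
    proof (rule mult_left_mono)
      show "measure \<mu> (X \<inter> ball x (2 * Cb * d)) \<le> D * measure \<mu> B"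
        unfolding B_def using doubling_le[of x x "Cb * d" "2 * Cb * d" 1] scale x d(1) Cb
        by (simp add: mult.assoc)
    qed simp
    finally show ?thesis .
  qed
  define E1 where "E1 = {z\<in>X. 2 * \<nu> \<le> lower_lip X f z}"
  have E1: "E1 \<in> sets \<mu>"
  proof -
    have "lower_lip X f \<in> borel_measurable \<mu>"
      using lower_lip_measurable[OF f] by (simp cong: measurable_cong_sets add: sets_eq)
    then have "{z \<in> space \<mu>. 2 * \<nu> \<le> lower_lip X f z} \<in> sets \<mu>" by measurable
    then show ?thesis by (simp add: E1_def space_eq)
  qed
  have E1B: "E1 \<inter> B \<in> fmeasurable \<mu>"
    using fmeasurable_Int_fmeasurable[OF B(1) E1] by (simp add: Int_commute)
  have m1: "2 powr q * measure \<mu> (E1 \<inter> B) \<le> D * measure \<mu> B"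
  proof -
    have int: "set_integrable \<mu> (E1 \<inter> B) slope_power"
      using slope_power_integrable[OF x, of "Cb * d"] E1B
      by (rule set_integrable_subset[OF _ fmeasurableD]) (auto simp: B_def)
    have "(2 * \<nu>) powr q * measure \<mu> (E1 \<inter> B) \<le> (LINT z:E1 \<inter> B|\<mu>. slope_power z)"
      using E1B int
    proof (rule set_integral_ge_const)
      show "(2 * \<nu>) powr q \<le> slope_power z" if "z \<in> E1 \<inter> B" for z
        using that \<nu> q(1) by (intro powr_mono2) (auto simp: E1_def)
    qed
    also have "\<dots> \<le> I"
      unfolding I_def
    proof (rule set_integral_mono_domain[OF slope_power_nonneg slope_power_integrable[OF x] fmeasurableD[OF E1B]])
      have "Cb * d \<le> 2 * Cb * d" using Cb d(1) by simp
      then show "E1 \<inter> B \<subseteq> X \<inter> ball x (2 * Cb * d)" by (auto simp: B_def)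
    qed
    finally have "(2 * \<nu>) powr q * measure \<mu> (E1 \<inter> B) \<le> \<nu> powr q * (D * measure \<mu> B)"
      using I by linarith
    then have "\<nu> powr q * (2 powr q * measure \<mu> (E1 \<inter> B)) \<le> \<nu> powr q * (D * measure \<mu> B)"
      unfolding pow by (simp only: ac_simps)
    then show ?thesis using \<nu>q by simp
  qed
  define Z where "Z = {z\<in>X. dist x z < Cb * d \<and> \<not> averages_le X \<mu> slope_power z (Cb * d / 2) ((2 * \<nu>) powr q)}"
  have "\<exists>W\<in>fmeasurable \<mu>. Z \<subseteq> W \<and> (2 * \<nu>) powr q * measure \<mu> W \<le> D\<^sup>2 * I"
    unfolding I_def
  proof (rule weak_type_estimate[OF x slope_power_nonneg slope_power_integrable[OF x]])
    show "ereal (4 * (Cb * d / 2)) < r0" using scale by (simp add: mult.assoc)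
    show "dist x z + Cb * d / 2 \<le> 2 * Cb * d" if "z \<in> Z" for z
    proof -
      have "dist x z < Cb * d" using that by (simp add: Z_def)
      moreover have "0 \<le> Cb * d" using Cb d(1) by simp
      ultimately show ?thesis by linarith
    qed
  qed (use \<nu> in \<open>auto simp: Z_def\<close>)
  then obtain W where W: "W \<in> fmeasurable \<mu>" "Z \<subseteq> W" "(2 * \<nu>) powr q * measure \<mu> W \<le> D\<^sup>2 * I"
    by blast
  have m2: "2 powr q * measure \<mu> W \<le> D ^ 3 * measure \<mu> B"
  proof -
    have "D\<^sup>2 * I \<le> D\<^sup>2 * (\<nu> powr q * (D * measure \<mu> B))" using I by (rule mult_left_mono) simp
    with W(3) have "(2 * \<nu>) powr q * measure \<mu> W \<le> D\<^sup>2 * (\<nu> powr q * (D * measure \<mu> B))"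
      by linarith
    also have "D\<^sup>2 * (\<nu> powr q * (D * measure \<mu> B)) = \<nu> powr q * (D ^ 3 * measure \<mu> B)"
      by (simp add: power3_eq_cube power2_eq_square ac_simps)
    finally have "\<nu> powr q * (2 powr q * measure \<mu> W) \<le> \<nu> powr q * (D ^ 3 * measure \<mu> B)"
      unfolding pow by (simp only: ac_simps)
    then show ?thesis using \<nu>q by simp
  qed
  define E where "E = E1 \<union> W"
  have E: "E \<in> sets \<mu>" unfolding E_def using E1 W(1) by (auto dest: fmeasurableD)
  have "E \<inter> ball x (Cb * d) \<subseteq> (E1 \<inter> B) \<union> W"
    by (auto simp: E_def B_def E1_def)
  moreover have "E \<inter> ball x (Cb * d) = E \<inter> B"
    using sets.sets_into_space[OF E] by (auto simp: B_def space_eq)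
  ultimately have "measure \<mu> (E \<inter> ball x (Cb * d)) \<le> measure \<mu> ((E1 \<inter> B) \<union> W)"
    using E E1B W(1) B(1) by (intro measure_mono_fmeasurable) (auto dest: fmeasurableD)
  also have "\<dots> \<le> measure \<mu> (E1 \<inter> B) + measure \<mu> W"
    using E1B W(1) by (intro measure_Un_le fmeasurableD)
  finally have "2 powr q * measure \<mu> (E \<inter> ball x (Cb * d)) \<le> 2 powr q * (measure \<mu> (E1 \<inter> B) + measure \<mu> W)"
    by simp
  also have "\<dots> \<le> (D + D ^ 3) * measure \<mu> B" using m1 m2 by (simp add: algebra_simps)
  also have "\<dots> < (\<epsilon> * 2 powr q) * measure \<mu> B" using q(2) B(2) by (rule mult_strict_right_mono)
  finally have "measure \<mu> (E \<inter> ball x (Cb * d)) < \<epsilon> * measure \<mu> B" by (simp add: ac_simps)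
  moreover have "lower_lip X f z < 2 * \<nu>"
      "dist x z < Cb * d \<longrightarrow> averages_le X \<mu> slope_power z (Cb * d / 2) ((2 * \<nu>) powr q)"
    if "z \<in> X - E" for z
    using that W(2) by (auto simp: E_def E1_def Z_def)
  ultimately show ?thesis using E unfolding B_def by blast
qed

text \<open>Off its gaps the fragment contributes at most \<open>2 \<nu> T \<le> 2 Cb \<nu> d\<close>, and its gaps at most
\<open>(8 Cb \<nu> + A) d/4\<close>. The sum is \<open>(4 Cb \<nu> + A/4) d\<close>: the factor \<open>4 Cb\<close> in the inequality is the one
that is reproduced.\<close>
lemma Morrey_error_improves:
  assumes A: "0 \<le> A" and P: "Morrey_with_error A"
  shows "Morrey_with_error (A / 4)"
  unfolding Morrey_with_error_def
proof (intro allI impI, elim conjE)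
  fix \<nu> x y
  assume \<nu>: "0 < \<nu>" and xy: "x \<in> X" "y \<in> X" "0 < dist x y" "ereal (N * dist x y) < r0"
    and avg: "averages_le X \<mu> slope_power x (2 * Cb * dist x y) (\<nu> powr q)"
  define d where "d = dist x y"
  note d = xy(3,4)[folded d_def]
  obtain E where E: "E \<in> sets \<mu>" "measure \<mu> (E \<inter> ball x (Cb * d)) < \<epsilon> * measure \<mu> (X \<inter> ball x (Cb * d))"
      "\<And>z. z \<in> X - E \<Longrightarrow> lower_lip X f z < 2 * \<nu>"
      "\<And>z. z \<in> X - E \<Longrightarrow> dist x z < Cb * d \<Longrightarrow> averages_le X \<mu> slope_power z (Cb * d / 2) ((2 * \<nu>) powr q)"
    using bad_set_density[OF \<nu> xy(1,3,4) avg] unfolding d_def by blast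
  obtain T K \<gamma> where
    T: "0 < T" "T \<le> Cb * d" and K: "compact K" "K \<subseteq> {0..T}" "0 \<in> K" "T \<in> K"
    and \<gamma>: "1-lipschitz_on K \<gamma>" "\<gamma> ` K \<subseteq> X" "\<gamma> 0 = x" "\<gamma> T = y"
    and gap: "T - measure lebesgue K < d / 4"
    and avoid: "\<And>t. t \<in> K \<Longrightarrow> 0 < t \<Longrightarrow> t < T \<Longrightarrow> \<gamma> t \<notin> E"
    using joined[OF xy(1-4) E(1)] E(2) unfolding joined_by_fragment_def d_def by auto
  have dist\<gamma>: "dist (\<gamma> s) (\<gamma> t) \<le> t - s" if "s \<in> K" "t \<in> K" "s \<le> t" for s t
    using lipschitz_onD[OF \<gamma>(1) that(1,2)] that(3) by (simp add: dist_real_def)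
  have \<gamma>X: "\<gamma> t \<in> X" if "t \<in> K" for t using that \<gamma>(2) by blast
  define A' where "A' = 4 * Cb * (2 * \<nu>) + A"
  have A': "0 \<le> A'" using A Cb \<nu> by (simp add: A'_def)
  have "\<bar>f (\<gamma> T) - f (\<gamma> 0)\<bar> \<le> (2 * \<nu>) * T + A' * (T - measure lebesgue K)"
  proof (rule increment_bound_on_compact[OF K T(1)])
    show "continuous_on K (\<lambda>t. f (\<gamma> t))"
      using lipschitz_on_continuous_on[OF f] lipschitz_on_continuous_on[OF \<gamma>(1)] \<gamma>(2)
      by (rule continuous_on_compose2)
    show "0 \<le> 2 * \<nu>" using \<nu> by simp
    show "0 \<le> A'" by (rule A')
  next
    fix t e assume t: "t \<in> K" "0 < t" "t < T" and e: "0 < (e::real)"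
    have "lower_lip X f (\<gamma> t) < 2 * \<nu>" using E(3) \<gamma>X avoid t by auto
    then obtain h where h: "0 < h" "h < e" "\<And>z. z \<in> X \<inter> ball (\<gamma> t) h \<Longrightarrow> \<bar>f (\<gamma> t) - f z\<bar> \<le> 2 * \<nu> * h"
      using small_slope_if_lower_lip_less[OF f \<gamma>X[OF t(1)] _ e] by blast
    have "\<bar>f (\<gamma> s) - f (\<gamma> t)\<bar> \<le> 2 * \<nu> * h" if "s \<in> K" "t \<le> s" "s < t + h" for s
      using h(3)[of "\<gamma> s"] dist\<gamma>[OF t(1) that(1,2)] that \<gamma>X by (simp add: abs_minus_commute)
    then show "\<exists>h>0. h < e \<and> (\<forall>s\<in>K. t \<le> s \<and> s < t + h \<longrightarrow> \<bar>f (\<gamma> s) - f (\<gamma> t)\<bar> \<le> 2 * \<nu> * h)"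
      using h by blast
  next
    fix s t assume st: "s \<in> K" "t \<in> K" "s < t" "{s<..<t} \<inter> K = {}"
    define d' where "d' = dist (\<gamma> s) (\<gamma> t)"
    have d': "d' \<le> t - s" unfolding d'_def using dist\<gamma> st by simp
    then have d'4: "d' < d / 4" using gap_length_le[OF K(1,2) st] gap by simp
    have "\<bar>f (\<gamma> t) - f (\<gamma> s)\<bar> \<le> A' * d'"
    proof (cases "d' = 0")
      case True
      then have "\<gamma> s = \<gamma> t" by (simp add: d'_def)
      then show ?thesis using True by simp
    next
      case False
      then have d'0: "0 < d'" by (simp add: d'_def less_le)
      have "N * d' \<le> N * d" using d'4 d'0 Cb N by (intro mult_left_mono) auto
      then have scale: "ereal (N * d') < r0" using d(2) by (meson ereal_less_eq(3) le_less_trans)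
      have Cbd': "2 * Cb * d' \<le> Cb * d / 2" using d'4 Cb by (simp add: field_simps)
      have "averages_le X \<mu> slope_power (\<gamma> s) (2 * Cb * d') ((2 * \<nu>) powr q)"
      \<comment> \<open>A gap may begin at \<open>x\<close>, where the averages are controlled by assumption, or at a later point, which the
fragment keeps out of \<open>E\<close>.\<close>
      proof (cases "s = 0")
        case True
        have "Cb * d / 2 \<le> 2 * Cb * d" using Cb d(1) by simp
        then have "2 * Cb * d' \<le> 2 * Cb * d" using Cbd' by linarith
        moreover have "\<nu> powr q \<le> (2 * \<nu>) powr q" using \<nu> q(1) by (intro powr_mono2) auto
        ultimately show ?thesis
          using avg unfolding True \<gamma>(3) averages_le_def d_def[symmetric]
          by (meson mult_right_mono order_trans measure_nonneg)
      next
        case False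
        have s: "0 < s" "s < T" using False st K(2) by force+
        have "dist x (\<gamma> s) \<le> s" using dist\<gamma>[OF K(3) st(1)] s(1) \<gamma>(3) by simp
        then have "averages_le X \<mu> slope_power (\<gamma> s) (Cb * d / 2) ((2 * \<nu>) powr q)"
          using E(4)[of "\<gamma> s"] avoid[OF st(1) s] \<gamma>X[OF st(1)] s(2) T(2) by simp
        then show ?thesis using Cbd' unfolding averages_le_def by (meson order_trans)
      qed
      then show ?thesis
        using P[unfolded Morrey_with_error_def, rule_format, of "2 * \<nu>" "\<gamma> s" "\<gamma> t"]
          \<nu> \<gamma>X[OF st(1)] \<gamma>X[OF st(2)] d'0 scale
        unfolding A'_def d'_def abs_minus_commute[of "f (\<gamma> t)"] by simp
    qed
    also have "\<dots> \<le> A' * (t - s)" using d' A' by (rule mult_left_mono)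
    finally show "\<bar>f (\<gamma> t) - f (\<gamma> s)\<bar> \<le> A' * (t - s)" .
  qed
  also have "\<dots> \<le> (2 * \<nu>) * (Cb * d) + A' * (d / 4)"
    using T(2) gap \<nu> A' by (intro add_mono mult_left_mono) auto
  also have "\<dots> = (4 * Cb * \<nu> + A / 4) * d" by (simp add: A'_def field_simps)
  finally show "\<bar>f x - f y\<bar> \<le> (4 * Cb * \<nu> + A / 4) * dist x y"
    by (simp add: \<gamma> d_def abs_minus_commute)
qed

lemma Morrey_inequality:
  assumes "0 < \<nu>" "x \<in> X" "y \<in> X" "0 < dist x y" "ereal (N * dist x y) < r0"
    and "averages_le X \<mu> slope_power x (2 * Cb * dist x y) (\<nu> powr q)"
  shows "\<bar>f x - f y\<bar> \<le> 4 * Cb * \<nu> * dist x y"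
proof -
  have L: "0 \<le> L" using f by (rule lipschitz_on_nonneg)
  have P: "Morrey_with_error (L * (1 / 4) ^ n)" for n
  proof (induction n)
    case 0
    show ?case unfolding Morrey_with_error_def
    proof (intro allI impI, elim conjE)
      fix \<nu> :: real and x y assume a: "0 < \<nu>" "x \<in> X" "y \<in> X"
      have "\<bar>f x - f y\<bar> \<le> L * dist x y"
        using lipschitz_onD[OF f a(2,3)] by (simp add: dist_real_def)
      also have "\<dots> \<le> (4 * Cb * \<nu> + L * (1 / 4) ^ 0) * dist x y"
        using a(1) Cb by (intro mult_right_mono) auto
      finally show "\<bar>f x - f y\<bar> \<le> (4 * Cb * \<nu> + L * (1 / 4) ^ 0) * dist x y" .
    qed
  next
    case (Suc n)
    have "0 \<le> L * (1 / 4) ^ n" using L by simp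
    from Morrey_error_improves[OF this Suc] show ?case by (simp add: field_simps)
  qed
  have "\<bar>f x - f y\<bar> \<le> (4 * Cb * \<nu> + L * (1 / 4) ^ n) * dist x y" for n
    using P[of n] assms unfolding Morrey_with_error_def by blast
  moreover have "(\<lambda>n. (4 * Cb * \<nu> + L * (1 / 4) ^ n) * dist x y) \<longlonglongrightarrow> (4 * Cb * \<nu> + L * 0) * dist x y"
    by (intro tendsto_intros) (simp_all add: LIMSEQ_power_zero)
  ultimately show ?thesis
    using LIMSEQ_le_const[of _ _ "\<bar>f x - f y\<bar>"] by fastforce
qed

end
end

section \<open>The Poincare inequality\<close>

context doubling_space
begin

text \<open>Some point \<open>z\<close> of the ball has averages of \<open>u\<close> bounded by \<open>(\<kappa> s)\<^sup>q\<close>, because by the weak type inequality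
the other points form a set smaller than the ball. The Morrey inequality based at \<open>z\<close> reaches all other points of
the ball.\<close>
lemma mean_oscillation_le_if_average_less:
  fixes Cb \<epsilon> N M q L s :: real and f :: "'a \<Rightarrow> real"
  assumes Cb: "1 \<le> Cb" and q: "1 \<le> q" "D + D ^ 3 < \<epsilon> * 2 powr q" and N: "2 * Cb \<le> N"
    and joined: "\<And>E x y. x \<in> X \<Longrightarrow> y \<in> X \<Longrightarrow> 0 < dist x y \<Longrightarrow> ereal (N * dist x y) < r0 \<Longrightarrow> E \<in> sets \<mu> \<Longrightarrow>
      measure \<mu> (E \<inter> ball x (Cb * dist x y)) < \<epsilon> * measure \<mu> (X \<inter> ball x (Cb * dist x y)) \<Longrightarrow>
      joined_by_fragment X E Cb (1 / 4) x y"
    and f: "L-lipschitz_on X f"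
    and m: "1 + 4 * Cb \<le> 2 ^ m" and M: "2 * N \<le> M" "16 * Cb \<le> M" "2 ^ m \<le> M"
    and x0: "x0 \<in> X" and r: "0 < r" "ereal (M * r) < r0" and s: "0 < s"
    and avg_less: "avg \<mu> (X \<inter> ball x0 ((1 + 4 * Cb) * r)) (\<lambda>z. lower_lip X f z powr q) \<le> s powr q"
  shows "mean_oscillation \<mu> (X \<inter> ball x0 r) f \<le> (16 * Cb * (D ^ (m + 2) + 1)) * r * s"
proof -
  have scale: "ereal (a * r) < r0" if "a \<le> M" for a
  proof -
    have "a * r \<le> M * r" using that r by (intro mult_right_mono) auto
    then show ?thesis using r(2) by (meson ereal_less_eq(3) le_less_trans)
  qed
  define u where "u = (\<lambda>z. lower_lip X f z powr q)"
  have u: "0 \<le> u z" for z by (simp add: u_def)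
  have u_int: "set_integrable \<mu> (X \<inter> ball x \<rho>) u" if "x \<in> X" for x \<rho>
    unfolding u_def using lower_lip_powr_integrable[OF f _ that] q(1) by simp
  define B where "B = X \<inter> ball x0 r"
  have B: "B \<in> fmeasurable \<mu>" "0 < measure \<mu> B"
    unfolding B_def using ball_fmeasurable ball_pos x0 r(1) by auto
  define R where "R = (1 + 4 * Cb) * r"
  have "0 < R" using Cb r(1) by (simp add: R_def)
  then have "0 < measure \<mu> (X \<inter> ball x0 R)" using ball_pos x0 by simp
  then have "(LINT z:X \<inter> ball x0 R|\<mu>. u z) \<le> s powr q * measure \<mu> (X \<inter> ball x0 R)"
    using avg_less by (simp add: avg_def u_def R_def field_simps)
  also have "\<dots> \<le> s powr q * (D ^ m * measure \<mu> B)"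
  proof (rule mult_left_mono)
    have "R \<le> 2 ^ m * r" unfolding R_def using m r(1) by (intro mult_right_mono) auto
    then show "measure \<mu> (X \<inter> ball x0 R) \<le> D ^ m * measure \<mu> B"
      unfolding B_def using scale[OF M(3)] x0 r(1) by (intro doubling_le) auto
  qed simp
  finally have I: "(LINT z:X \<inter> ball x0 R|\<mu>. u z) \<le> s powr q * (D ^ m * measure \<mu> B)" .
  define \<kappa> where "\<kappa> = D ^ (m + 2) + 1"
  have \<kappa>: "1 \<le> \<kappa>" "D ^ (m + 2) < \<kappa> powr q"
  proof -
    show "1 \<le> \<kappa>" using D by (simp add: \<kappa>_def)
    then have "\<kappa> powr 1 \<le> \<kappa> powr q" using q(1) by (intro powr_mono) auto
    then show "D ^ (m + 2) < \<kappa> powr q" using \<open>1 \<le> \<kappa>\<close> by (simp add: \<kappa>_def)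
  qed
  define Z where "Z = {z\<in>B. \<not> averages_le X \<mu> u z (4 * Cb * r) ((\<kappa> * s) powr q)}"
  have "\<exists>W\<in>fmeasurable \<mu>. Z \<subseteq> W \<and>
      (\<kappa> * s) powr q * measure \<mu> W \<le> D\<^sup>2 * (LINT z:X \<inter> ball x0 R|\<mu>. u z)"
  proof (rule weak_type_estimate[OF x0 u u_int[OF x0]])
    show "ereal (4 * (4 * Cb * r)) < r0" using scale[OF M(2)] by (simp add: ac_simps)
    show "dist x0 z + 4 * Cb * r \<le> R" if "z \<in> Z" for z
      using that by (auto simp: Z_def B_def R_def algebra_simps)
  qed (use \<kappa> s in \<open>auto simp: Z_def B_def\<close>)
  then obtain W where W: "W \<in> fmeasurable \<mu>" "Z \<subseteq> W"
      "(\<kappa> * s) powr q * measure \<mu> W \<le> D\<^sup>2 * (LINT z:X \<inter> ball x0 R|\<mu>. u z)" by blast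
  have "s powr q * (\<kappa> powr q * measure \<mu> W) \<le> s powr q * (D ^ (m + 2) * measure \<mu> B)"
  proof -
    have "D\<^sup>2 * (LINT z:X \<inter> ball x0 R|\<mu>. u z) \<le> D\<^sup>2 * (s powr q * (D ^ m * measure \<mu> B))"
      using I by (rule mult_left_mono) simp
    with W(3) have "(\<kappa> * s) powr q * measure \<mu> W \<le> D\<^sup>2 * (s powr q * (D ^ m * measure \<mu> B))"
      by (rule order_trans)
    also have "D\<^sup>2 * (s powr q * (D ^ m * measure \<mu> B)) = s powr q * (D ^ (m + 2) * measure \<mu> B)"
      by (simp add: power_add power2_eq_square ac_simps)
    also have "(\<kappa> * s) powr q = \<kappa> powr q * s powr q" using \<kappa>(1) s by (simp add: powr_mult)
    finally show ?thesis by (simp only: ac_simps)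
  qed
  then have "\<kappa> powr q * measure \<mu> W \<le> D ^ (m + 2) * measure \<mu> B"
    using s by simp
  also have "\<dots> < \<kappa> powr q * measure \<mu> B" using \<kappa>(2) B(2) by (rule mult_strict_right_mono)
  finally have "measure \<mu> W < measure \<mu> B" using \<kappa>(1) by simp
  then have "\<not> B \<subseteq> W"
    using measure_mono_fmeasurable[of B W \<mu>] fmeasurableD[OF B(1)] W(1) by force
  then obtain z where z: "z \<in> B" "averages_le X \<mu> u z (4 * Cb * r) ((\<kappa> * s) powr q)"
    using W(2) unfolding Z_def by blast
  have "\<bar>f w - f z\<bar> \<le> 8 * Cb * \<kappa> * r * s" if w: "w \<in> B" for w
  proof (cases "z = w")
    case True
    then show ?thesis using Cb \<kappa>(1) r(1) s by simp
  next
    case False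
    have zw: "dist z w \<le> 2 * r"
      using z(1) w dist_triangle[of z w x0] by (auto simp: B_def dist_commute)
    have "N * dist z w \<le> (2 * N) * r" using mult_left_mono[OF zw, of N] N Cb by simp
    then have "ereal (N * dist z w) < r0"
      using scale[OF M(1)] by (meson ereal_less_eq(3) le_less_trans)
    note scale' = this
    have avg_zw: "averages_le X \<mu> u z (2 * Cb * dist z w) ((\<kappa> * s) powr q)"
    proof -
      have "2 * Cb * dist z w \<le> 4 * Cb * r" using mult_left_mono[OF zw, of "2 * Cb"] Cb by simp
      then show ?thesis using z(2) unfolding averages_le_def by (meson order_trans)
    qed
    have "\<bar>f z - f w\<bar> \<le> 4 * Cb * (\<kappa> * s) * dist z w"
    proof (rule Morrey_inequality[OF Cb q N _ f])
      show "0 < \<kappa> * s" using \<kappa>(1) s by simp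
      show "z \<in> X" "w \<in> X" using z(1) w by (auto simp: B_def)
      show "0 < dist z w" using False by simp
      show "ereal (N * dist z w) < r0" by (rule scale')
      show "averages_le X \<mu> (\<lambda>z. lower_lip X f z powr q) z (2 * Cb * dist z w) ((\<kappa> * s) powr q)"
        using avg_zw by (simp add: u_def)
    qed (rule joined)
    also have "\<dots> \<le> 4 * Cb * (\<kappa> * s) * (2 * r)" using zw Cb \<kappa>(1) s by (intro mult_left_mono) auto
    finally show ?thesis by (simp add: abs_minus_commute ac_simps)
  qed
  then have "mean_oscillation \<mu> B f \<le> 2 * (8 * Cb * \<kappa> * r * s)"
    using lipschitz_set_integrable[OF f x0] unfolding B_def
    by (intro mean_oscillation_le_oscillation[OF B[unfolded B_def]]) auto
  then show ?thesis by (simp add: B_def \<kappa>_def ac_simps)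
qed

text \<open>The strictly positive \<open>s\<close> of the previous lemma approaches the \<open>q\<close>-th root of the average, which may be \<open>0\<close>.\<close>
lemma Poincare_1q_if_joined_by_fragments:
  fixes Cb \<epsilon> N M q :: real
  assumes Cb: "1 \<le> Cb" and q: "1 \<le> q" "D + D ^ 3 < \<epsilon> * 2 powr q" and N: "2 * Cb \<le> N"
    and joined: "\<And>E x y. x \<in> X \<Longrightarrow> y \<in> X \<Longrightarrow> 0 < dist x y \<Longrightarrow> ereal (N * dist x y) < r0 \<Longrightarrow> E \<in> sets \<mu> \<Longrightarrow>
      measure \<mu> (E \<inter> ball x (Cb * dist x y)) < \<epsilon> * measure \<mu> (X \<inter> ball x (Cb * dist x y)) \<Longrightarrow>
      joined_by_fragment X E Cb (1 / 4) x y"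
    and m: "1 + 4 * Cb \<le> 2 ^ m" and M: "2 * N \<le> M" "16 * Cb \<le> M" "2 ^ m \<le> M"
    and R: "\<And>r. 0 < r \<Longrightarrow> ereal r < R \<Longrightarrow> ereal (M * r) < r0"
  shows "Poincare_1q q (1 + 4 * Cb) (16 * Cb * (D ^ (m + 2) + 1)) R X \<mu>"
  unfolding Poincare_1q_def
proof (intro allI impI ballI, elim exE)
  fix f :: "'a \<Rightarrow> real" and x r L
  assume x: "x \<in> X" and r: "0 < r" "ereal r < R" and f: "L-lipschitz_on X f"
  define a where "a = avg \<mu> (X \<inter> ball x ((1 + 4 * Cb) * r)) (\<lambda>y. lower_lip X f y powr q)"
  define c where "c = 16 * Cb * (D ^ (m + 2) + 1) * r"
  have "0 < c" using Cb D r(1) by (simp add: c_def add_nonneg_pos)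
  have "0 \<le> a"
    unfolding a_def using Cb r(1) x lower_lip_powr_integrable[OF f _ x] q(1)
    by (intro le_avg ball_fmeasurable ball_pos) auto
  have "mean_oscillation \<mu> (X \<inter> ball x r) f \<le> c * a powr (1 / q)"
  proof (rule field_le_epsilon)
    fix e :: real assume "0 < e"
    define s where "s = a powr (1 / q) + e / c"
    have s: "0 < s" using \<open>0 < e\<close> \<open>0 < c\<close> by (simp add: s_def add_nonneg_pos)
    have "a = (a powr (1 / q)) powr q" using \<open>0 \<le> a\<close> q(1) by (simp add: powr_powr)
    also have "\<dots> \<le> s powr q"
      using \<open>0 < e\<close> \<open>0 < c\<close> q(1) by (intro powr_mono2) (auto simp: s_def)
    finally have "a \<le> s powr q" .
    then have "mean_oscillation \<mu> (X \<inter> ball x r) f \<le> c * s"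
      unfolding a_def c_def
      by (intro mean_oscillation_le_if_average_less[OF Cb q N _ f m M x r(1) R[OF r] s]) (rule joined)
    then show "mean_oscillation \<mu> (X \<inter> ball x r) f \<le> c * a powr (1 / q) + e"
      using \<open>0 < c\<close> by (simp add: s_def distrib_left)
  qed
  then show "mean_oscillation \<mu> (X \<inter> ball x r) f
     \<le> 16 * Cb * (D ^ (m + 2) + 1) * r *
        avg \<mu> (X \<inter> ball x ((1 + 4 * Cb) * r)) (\<lambda>y. lower_lip X f y powr q) powr (1 / q)"
    unfolding a_def c_def .
qed

end

theorem theorem1p4:
  fixes D C :: real and r0 :: ereal and \<Phi> \<Psi> :: "real \<Rightarrow> real"
  assumes "0 < r0" and "0 < C"
    and "increasing_modulus \<Phi>" and "increasing_modulus \<Psi>"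
  shows "\<exists>q Cbar \<delta> \<epsilon> r1 C' C_PI :: real. \<exists>R :: ereal.
    1 \<le> q \<and> 1 \<le> Cbar \<and> \<delta> \<in> {0<..<1} \<and> \<epsilon> \<in> {0<..<1} \<and>
    0 < r1 \<and> 0 < C' \<and> 0 < C_PI \<and> 0 < R \<and> (r0 = \<infinity> \<longrightarrow> R = \<infinity>) \<and>
    (\<forall>(X :: 'a::metric_space set) \<mu>.
       metric_measure_space X \<mu> \<and> doubling D r0 X \<mu> \<and>
       nonhomogeneous_Poincare \<Phi> \<Psi> C r0 X \<mu> \<longrightarrow>
       locally_connected_at_scale r1 Cbar \<delta> \<epsilon> X \<mu> \<and>
       Poincare_1q q C' C_PI R X \<mu>)"
proof -
  define D' where "D' = max 1 D"
  have D': "1 \<le> D'" by (simp add: D'_def)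
  obtain Cb \<epsilon> M0 :: real where c: "1 \<le> Cb" "0 < \<epsilon>" "\<epsilon> < 1" "0 < M0"
    and joined: "\<And>(X :: 'a set) \<mu> r0 E x y. doubling_space X \<mu> D' r0 \<Longrightarrow>
       nonhomogeneous_Poincare \<Phi> \<Psi> C r0 X \<mu> \<Longrightarrow> x \<in> X \<Longrightarrow> y \<in> X \<Longrightarrow> 0 < dist x y \<Longrightarrow>
       ereal (M0 * dist x y) < r0 \<Longrightarrow> E \<in> sets \<mu> \<Longrightarrow>
       measure \<mu> (E \<inter> ball x (Cb * dist x y)) < \<epsilon> * measure \<mu> (X \<inter> ball x (Cb * dist x y)) \<Longrightarrow>
       joined_by_fragment X E Cb (1 / 4) x y"
    using joined_by_fragment_constants[OF assms(2-4) D', of "1 / 4", where ?'a = 'a] by auto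
  define N where "N = max M0 (2 * Cb)"
  obtain n :: nat where n: "(D' + D' ^ 3) / \<epsilon> < 2 ^ n" using real_arch_pow[of 2] by auto
  define q where "q = real (max 1 n)"
  have q: "1 \<le> q" "D' + D' ^ 3 < \<epsilon> * 2 powr q"
  proof -
    show "1 \<le> q" by (simp add: q_def)
    have "(2::real) ^ n \<le> 2 ^ max 1 n" by (rule power_increasing) auto
    also have "\<dots> = 2 powr q" unfolding q_def by (rule powr_realpow[symmetric]) simp
    finally have "\<epsilon> * 2 ^ n \<le> \<epsilon> * 2 powr q" using c(2) by simp
    moreover have "D' + D' ^ 3 < \<epsilon> * 2 ^ n" using n c(2) by (simp add: field_simps)
    ultimately show "D' + D' ^ 3 < \<epsilon> * 2 powr q" by linarith
  qed
  obtain m :: nat where "1 + 4 * Cb < 2 ^ m" using real_arch_pow[of 2] by auto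
  then have m: "1 + 4 * Cb \<le> 2 ^ m" by simp
  define M where "M = max (2 * N) (max (16 * Cb) (2 ^ m))"
  have M: "0 < M" "M0 \<le> M" using c by (auto simp: M_def N_def)
  \<comment> \<open>All scales are restricted by \<open>M r < r0\<close>; for \<open>r0 = \<infinity>\<close> this is no restriction, and any \<open>r1\<close> serves.\<close>
  obtain R :: ereal and r1 :: real where R: "0 < R" "r0 = \<infinity> \<Longrightarrow> R = \<infinity>" "\<And>r. ereal r < R \<Longrightarrow> ereal (M * r) < r0"
    and r1: "0 < r1" "ereal r1 < R"
  proof (cases r0)
    case (real a)
    then have "0 < a" using assms(1) by simp
    show ?thesis
      by (rule that[of "ereal (a / M)" "a / (2 * M)"])
         (use real \<open>0 < a\<close> M(1) in \<open>auto simp: field_simps\<close>)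
  next
    case PInf
    show ?thesis by (rule that[of \<infinity> 1]) (use PInf in auto)
  qed (use assms(1) in auto)
  have "locally_connected_at_scale r1 Cb (1 / 4) \<epsilon> X \<mu> \<and>
      Poincare_1q q (1 + 4 * Cb) (16 * Cb * (D' ^ (m + 2) + 1)) R X \<mu>"
    if h: "metric_measure_space X \<mu>" "doubling D r0 X \<mu>" "nonhomogeneous_Poincare \<Phi> \<Psi> C r0 X \<mu>"
    for X :: "'a set" and \<mu>
  proof
    have "doubling D' r0 X \<mu>"
      using h(2) unfolding doubling_def D'_def
      by (meson max.cobounded2 measure_nonneg mult_right_mono order_trans)
    then interpret doubling_space X \<mu> D' r0
      using h(1) D' by unfold_locales
    note joined' = joined[OF doubling_space_axioms h(3)]
    show "locally_connected_at_scale r1 Cb (1 / 4) \<epsilon> X \<mu>"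
      unfolding locally_connected_at_scale_def
    proof (intro ballI impI, elim conjE)
      fix x y assume xy: "x \<in> X" "y \<in> X" "0 < dist x y" "dist x y \<le> r1"
      have "ereal (dist x y) < R" using xy(4) r1(2) by (meson ereal_less_eq(3) le_less_trans)
      then have "ereal (M * dist x y) < r0" by (rule R(3))
      moreover have "M0 * dist x y \<le> M * dist x y" using M(2) by (intro mult_right_mono) auto
      ultimately have "ereal (M0 * dist x y) < r0" by (meson ereal_less_eq(3) le_less_trans)
      then show "connected_pair Cb (1 / 4) \<epsilon> X \<mu> x y"
        using xy(3) joined'[OF xy(1-3)] by (intro connected_pair_if_joined_by_fragment)
    qed
    show "Poincare_1q q (1 + 4 * Cb) (16 * Cb * (D' ^ (m + 2) + 1)) R X \<mu>"
    proof (rule Poincare_1q_if_joined_by_fragments[OF c(1) q _ _ m])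
      fix E x y
      assume a: "x \<in> X" "y \<in> X" "0 < dist x y" "ereal (N * dist x y) < r0" "E \<in> sets \<mu>"
        "measure \<mu> (E \<inter> ball x (Cb * dist x y)) < \<epsilon> * measure \<mu> (X \<inter> ball x (Cb * dist x y))"
      have "M0 * dist x y \<le> N * dist x y" by (intro mult_right_mono) (auto simp: N_def)
      then have "ereal (M0 * dist x y) < r0" using a(4) by (meson ereal_less_eq(3) le_less_trans)
      then show "joined_by_fragment X E Cb (1 / 4) x y" using joined' a by blast
    next
      show "2 * Cb \<le> N" by (simp add: N_def)
      show "2 * N \<le> M" "16 * Cb \<le> M" "2 ^ m \<le> M" by (auto simp: M_def)
      show "ereal (M * r) < r0" if "0 < r" "ereal r < R" for r using that(2) by (rule R(3))
    qed
  qed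
  then have "\<forall>(X :: 'a set) \<mu>.
       metric_measure_space X \<mu> \<and> doubling D r0 X \<mu> \<and>
       nonhomogeneous_Poincare \<Phi> \<Psi> C r0 X \<mu> \<longrightarrow>
       locally_connected_at_scale r1 Cb (1 / 4) \<epsilon> X \<mu> \<and>
       Poincare_1q q (1 + 4 * Cb) (16 * Cb * (D' ^ (m + 2) + 1)) R X \<mu>"
    by blast
  moreover have "0 < 16 * Cb * (D' ^ (m + 2) + 1)" using c D' by (simp add: add_nonneg_pos)
  moreover have "0 < 1 + 4 * Cb" using c(1) by simp
  moreover have "(1 / 4 :: real) \<in> {0<..<1}" "\<epsilon> \<in> {0<..<1}" using c by simp_all
  moreover have "r0 = \<infinity> \<longrightarrow> R = \<infinity>" using R(2) by blast
  ultimately show ?thesis using c(1) q(1) R(1) r1(1) by blast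
qed

end
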